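(* Let $a > 0$ and let $g$ be a function in $L^1(\mathbb{R})$ whose Fourier transform has compact support, $\operatorname{supp} \hat g \subset [-a, a]$. Let $p_g$ be the best $\mathcal{H}^1$-approximation of $g$ in $L^1(\mathbb{R})$. Then $\operatorname{supp} \hat p_g \subset [0, a]$.
   Context: $\mathcal{H}^1$ is the Hardy space in the upper half-plane $\mathbb{C}_+$, identified via angular boundary values with a closed subspace of $L^1(\mathbb{R})$. The Fourier transform is $\hat f(\xi) = \int_{\mathbb{R}} f(x) e^{-ix\xi}\,dx$ (up to a constant factor), so that a function $f \in L^1(\mathbb{R})$ belongs to $\mathcal{H}^1$ if and only if $\operatorname{supp}\hat f \subset [0, +\infty)$. The best $\mathcal{H}^1$-approximation of $g$ is the function $p_g \in \mathcal{H}^1$ with $\|g - p_g\|_{L^1(\mathbb{R})} = \inf_{h \in \mathcal{H}^1} \|g - h\|_{L^1(\mathbb{R})}$. *)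

theory Defs
  imports "HOL-Analysis.Analysis"
begin

text \<open>Elements of \<open>L\<^sup>1(\<real>)\<close> are represented by Borel measurable, integrable functions
  \<open>real \<Rightarrow> complex\<close>; nothing below depends on the representative of the almost-everywhere class.\<close>

definition L1_norm :: "(real \<Rightarrow> complex) \<Rightarrow> real" where
  "L1_norm f = (LINT x|lborel. cmod (f x))"

definition fourier :: "(real \<Rightarrow> complex) \<Rightarrow> real \<Rightarrow> complex" where
  "fourier f \<xi> = (LINT x|lborel. f x * exp (- \<i> * complex_of_real (x * \<xi>)))"

definition supp :: "(real \<Rightarrow> complex) \<Rightarrow> real set" where
  "supp u = closure {\<xi>. u \<xi> \<noteq> 0}"

definition upper_half_plane :: "complex set" where
  "upper_half_plane = {z. 0 < Im z}"

text \<open>The Hardy space as a space of holomorphic functions on the upper half-plane. Integrability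
  is required explicitly because the Bochner integral of a non-integrable function is 0.\<close>

definition hardy_space :: "(complex \<Rightarrow> complex) set" where
  "hardy_space = {F. F holomorphic_on upper_half_plane \<and>
     (\<exists>C. \<forall>y>0. integrable lborel (\<lambda>x. F (Complex x y)) \<and>
                 L1_norm (\<lambda>x. F (Complex x y)) \<le> C)}"

text \<open>The Stolz angle of aperture \<open>\<alpha>\<close> with vertex at the boundary point \<open>x\<close>.\<close>

definition stolz_angle :: "real \<Rightarrow> real \<Rightarrow> complex set" where
  "stolz_angle \<alpha> x = {z. 0 < Im z \<and> \<bar>Re z - x\<bar> < \<alpha> * Im z}"

definition has_angular_limit :: "(complex \<Rightarrow> complex) \<Rightarrow> real \<Rightarrow> complex \<Rightarrow> bool" where
  "has_angular_limit F x l \<longleftrightarrow>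
     (\<forall>\<alpha>>0. (F \<longlongrightarrow> l) (at (complex_of_real x) within stolz_angle \<alpha> x))"

text \<open>The same space as a subspace of \<open>L\<^sup>1(\<real>)\<close>, via angular boundary values.\<close>

definition H1 :: "(real \<Rightarrow> complex) set" where
  "H1 = {f. integrable lborel f \<and>
     (\<exists>F\<in>hardy_space. AE x in lborel. has_angular_limit F x (f x))}"

definition best_H1_approx :: "(real \<Rightarrow> complex) \<Rightarrow> (real \<Rightarrow> complex) \<Rightarrow> bool" where
  "best_H1_approx g p \<longleftrightarrow>
     p \<in> H1 \<and> L1_norm (\<lambda>x. g x - p x) = (INF h\<in>H1. L1_norm (\<lambda>x. g x - h x))"

end

theory Submission
  imports Defs "HOL-Complex_Analysis.Complex_Analysis" "HOL-Probability.Sinc_Integral"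
begin

text \<open>
  Let \<open>f = g - p\<close>. Since \<open>p\<close> has no negative frequencies, the spectrum of \<open>f\<close> lies in \<open>[-a, \<infinity>)\<close>;
  it has to be shown that \<open>f\<close> has no frequency above \<open>a\<close> either.

  Minimality of \<open>p\<close> means that \<open>f\<close> is at least as close to \<open>0\<close> as to any \<open>c u\<close>, for
  \<open>u\<close> integrable without negative frequencies. If moreover \<open>\<bar>u\<bar> \<le> \<bar>f\<bar>\<close> pointwise, then the norm is
  differentiable in the direction \<open>u\<close>, because the zeros of \<open>f\<close> are also zeros of \<open>u\<close>, and hence
  \<open>\<integral> u \<cdot> cnj (sgn f) = 0\<close> (\<open>L1_minimal_imp_orthogonal\<close>). This is applied twice.
  For \<open>\<xi> < -a\<close>, the function \<open>u(x) = f(x) exp(-i\<xi>x)\<close> is admissible, and \<open>u \<cdot> cnj (sgn f) = \<bar>f\<bar> exp(-i\<xi>x)\<close>: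
  so \<open>\<bar>f\<bar>\<close> has no frequency below \<open>-a\<close>. Consequently, for \<open>\<xi> > a\<close>, the function
  \<open>u(x) = \<bar>f(x)\<bar> exp(i\<xi>x)\<close> is admissible, and \<open>u \<cdot> cnj (sgn f)\<close> is the conjugate of \<open>f(x) exp(-i\<xi>x)\<close>:
  so \<open>f\<close> has no frequency above \<open>a\<close>.

  The argument relies on both directions of the description of the Hardy space by spectra.

  An integrable \<open>u\<close> without negative frequencies is a limit in \<open>L\<^sup>1\<close> of elements of the Hardy space,
  namely of its convolutions with Poisson kernels (\<open>poisson_smoothing_in_H1\<close>,
  \<open>poisson_smoothing_tendsto\<close>): the Poisson kernel is, up to a constant factor, the difference of the
  Cauchy kernels at \<open>z\<close> and \<open>cnj z\<close>, and the spectral condition says that the second one integrates \<open>u\<close> to \<open>0\<close>.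

  Conversely, a boundary function has no negative frequencies (\<open>fourier_H1_eq_0\<close>). This is
  the theorem of F. and M. Riesz: one must exclude that part of the mass of \<open>F(x + iy)\<close>
  concentrates on a null set as \<open>y\<close> tends to \<open>0\<close>. Mass can only concentrate where \<open>\<bar>F\<bar>\<close> is large, that is,
  in Stolz angles over a small open set \<open>U\<close>. A holomorphic function \<open>k\<close> with \<open>\<bar>k\<bar> \<le> 1\<close> is constructed
  which is small on the part of the half-plane above \<open>U\<close> and, in the mean, close to \<open>1\<close>; the integral of \<open>F k b\<close>
  over horizontal lines vanishes for suitable \<open>b\<close>, and \<open>k\<close> can be removed in the limit.
\<close>

section \<open>Continuity of translations in the mean\<close>

lemma integrable_shift:
  fixes u :: "real \<Rightarrow> 'a::{banach, second_countable_topology}"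
  assumes "integrable lborel u"
  shows "integrable lborel (\<lambda>x. u (x - s))"
  using lborel_integrable_real_affine[OF assms, of 1 "-s"] by simp

lemma integral_shift:
  fixes u :: "real \<Rightarrow> 'a::{banach, second_countable_topology}"
  shows "(LINT x|lborel. u (x - s)) = (LINT x|lborel. u x)"
  using lborel_integral_real_affine[of 1 u "-s"] by simp

text \<open>For an open set dominated convergence suffices: a point of \<open>U\<close> stays in \<open>U\<close> under small translations,
  so the part of \<open>U\<close> lost by translation tends to \<open>0\<close> by dominated convergence, and the part gained has
  the same measure.\<close>

lemma translation_continuous_open:
  fixes U :: "real set"
  assumes "open U" "emeasure lborel U < \<infinity>" "X \<longlonglongrightarrow> 0"
  shows "(\<lambda>n. LINT x|lborel. \<bar>indicat_real U (x - X n) - indicat_real U x\<bar>) \<longlonglongrightarrow> 0"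
proof -
  have [measurable]: "U \<in> sets borel" using assms(1) by auto
  have iU: "integrable lborel (indicat_real U)"
    using assms by (intro integrable_real_indicator) auto
  have iUs: "integrable lborel (\<lambda>x. indicat_real U (x - s))" for s
    by (rule integrable_shift[OF iU])
  define D where "D n x = indicat_real U x * (1 - indicat_real U (x - X n))" for n x
  have iD: "integrable lborel (D n)" for n
    unfolding D_def by (rule Bochner_Integration.integrable_bound[OF iU]) (auto simp: indicator_def)
  have "(\<lambda>n. LINT x|lborel. D n x) \<longlonglongrightarrow> (LINT x::real|lborel. (0::real))"
  proof (rule integral_dominated_convergence[where w="indicat_real U"])
    have "(\<lambda>n. D n x) \<longlonglongrightarrow> 0" for x
    proof (cases "x \<in> U")
      case True
      have "(\<lambda>n. x - X n) \<longlonglongrightarrow> x - 0" by (intro tendsto_intros assms)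
      then have "eventually (\<lambda>n. x - X n \<in> U) sequentially"
        using topological_tendstoD[OF _ \<open>open U\<close>] True by auto
      then have "eventually (\<lambda>n. D n x = 0) sequentially"
        by (rule eventually_mono) (simp add: D_def)
      then show ?thesis by (rule tendsto_eventually)
    qed (simp add: D_def)
    then show "AE x in lborel. (\<lambda>n. D n x) \<longlonglongrightarrow> 0" by simp
    show "AE x in lborel. norm (D n x) \<le> indicat_real U x" for n
      by (auto simp: D_def indicator_def)
  qed (auto simp: iU D_def)
  then have "(\<lambda>n. 2 * (LINT x|lborel. D n x)) \<longlonglongrightarrow> 0"
    by (auto intro: tendsto_eq_intros)
  moreover have "(LINT x|lborel. \<bar>indicat_real U (x - X n) - indicat_real U x\<bar>) = 2 * (LINT x|lborel. D n x)" for n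
  proof -
    have "(LINT x|lborel. \<bar>indicat_real U (x - X n) - indicat_real U x\<bar>)
       = (LINT x|lborel. 2 * D n x + (indicat_real U (x - X n) - indicat_real U x))"
      by (intro Bochner_Integration.integral_cong) (auto simp: D_def indicator_def)
    also have "\<dots> = 2 * (LINT x|lborel. D n x)
        + ((LINT x|lborel. indicat_real U (x - X n)) - (LINT x|lborel. indicat_real U x))"
      using iD iU iUs by simp
    also have "\<dots> = 2 * (LINT x|lborel. D n x)"
      by (simp only: integral_shift)
    finally show ?thesis .
  qed
  ultimately show ?thesis by simp
qed

text \<open>Indicators of Borel sets are reduced to open sets by outer regularity; sums and limits in the mean
  are harmless, as translations preserve the norm.\<close>

lemma translation_continuous_L1:
  fixes u :: "real \<Rightarrow> complex"
  assumes "integrable lborel u" "X \<longlonglongrightarrow> 0"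
  shows "(\<lambda>n. LINT x|lborel. cmod (u (x - X n) - u x)) \<longlonglongrightarrow> 0"
  using assms(1)
proof (induction u rule: integrable_induct)
  case (base A c)
  then have [measurable]: "A \<in> sets borel" by simp
  define w where "w B n = (LINT x|lborel. \<bar>indicat_real B (x - X n) - indicat_real B x\<bar>)" for B n
  have "w A \<longlonglongrightarrow> 0"
  proof (rule LIMSEQ_I)
    fix r :: real assume "r > 0"
    obtain U where U: "open U" "A \<subseteq> U" "emeasure lebesgue (U - A) < ennreal (r/4)"
    proof -
      have "A \<in> sets lebesgue" "r/4 > 0" using \<open>r > 0\<close> by simp_all
      then show ?thesis
        by (rule sets_lebesgue_outer_open) (rule that)
    qed
    have [measurable]: "U \<in> sets borel" using U by auto
    have UA: "emeasure lborel (U - A) < ennreal (r/4)" using U(3) by simp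
    have iA: "integrable lborel (indicat_real A)"
      using base by (intro integrable_real_indicator) auto
    have iUA: "integrable lborel (indicat_real (U - A))"
      using UA by (intro integrable_real_indicator) (auto simp: order.strict_trans[OF UA])
    have mUA: "(LINT x|lborel. indicat_real (U - A) x) < r/4"
    proof -
      have "emeasure lborel (U - A) \<noteq> top" using UA by auto
      from emeasure_eq_ennreal_measure[OF this] have "ennreal (measure lborel (U - A)) < ennreal (r/4)"
        using UA by simp
      then show ?thesis by (simp add: ennreal_less_iff)
    qed
    have "emeasure lborel U = emeasure lborel A + emeasure lborel (U - A)"
      using U(2) by (subst plus_emeasure) (auto intro!: arg_cong[where f="emeasure lborel"])
    then have "emeasure lborel U < \<infinity>"
      using base UA by (auto simp: order.strict_trans[OF UA])
    from order_tendstoD(2)[OF translation_continuous_open[OF U(1) this assms(2)], of "r/2"]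
    obtain N where N: "\<And>n. n \<ge> N \<Longrightarrow> w U n < r/2"
      using \<open>r > 0\<close> unfolding w_def eventually_sequentially by auto
    have iU: "integrable lborel (indicat_real U)"
      using \<open>emeasure lborel U < \<infinity>\<close> by (intro integrable_real_indicator) auto
    have "norm (w A n - 0) < r" if "n \<ge> N" for n
    proof -
      have "w A n \<le> (LINT x|lborel. \<bar>indicat_real U (x - X n) - indicat_real U x\<bar>
              + (indicat_real (U - A) (x - X n) + indicat_real (U - A) x))"
        unfolding w_def
      proof (rule integral_mono)
        fix x show "\<bar>indicat_real A (x - X n) - indicat_real A x\<bar> \<le> \<bar>indicat_real U (x - X n) - indicat_real U x\<bar>
              + (indicat_real (U - A) (x - X n) + indicat_real (U - A) x)"
          using U(2) by (auto simp: indicator_def)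
      qed (use iA iU iUA integrable_shift[OF iA] integrable_shift[OF iU] integrable_shift[OF iUA] in auto)
      also have "\<dots> = w U n + ((LINT x|lborel. indicat_real (U - A) (x - X n)) + (LINT x|lborel. indicat_real (U - A) x))"
        unfolding w_def
        using iA iU iUA integrable_shift[OF iA] integrable_shift[OF iU] integrable_shift[OF iUA] by simp
      also have "\<dots> = w U n + 2 * (LINT x|lborel. indicat_real (U - A) x)"
        by (simp only: integral_shift)
      also have "\<dots> < r" using N[OF that] mUA by linarith
      finally have "w A n < r" .
      moreover have "w A n \<ge> 0" unfolding w_def by (rule integral_nonneg_AE) auto
      ultimately show ?thesis by simp
    qed
    then show "\<exists>no. \<forall>n\<ge>no. norm (w A n - 0) < r" by auto
  qed
  then have "(\<lambda>n. w A n * cmod c) \<longlonglongrightarrow> 0" by (auto intro: tendsto_eq_intros)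
  moreover have "(LINT x|lborel. cmod (indicat_real A (x - X n) *\<^sub>R c - indicat_real A x *\<^sub>R c)) = w A n * cmod c" for n
    unfolding w_def by (subst integral_mult_left_zero[symmetric])
      (simp add: scaleR_left_diff_distrib[symmetric])
  ultimately show ?case by simp
next
  case (add f g)
  note i = add.hyps integrable_shift[OF add.hyps(1)] integrable_shift[OF add.hyps(2)]
  show ?case
  proof (rule tendsto_sandwich[OF _ _ tendsto_const])
    show "(\<lambda>n. (LINT x|lborel. cmod (f (x - X n) - f x)) + (LINT x|lborel. cmod (g (x - X n) - g x))) \<longlonglongrightarrow> 0"
      using tendsto_add[OF add.IH] by simp
    have "(LINT x|lborel. cmod (f (x - X n) + g (x - X n) - (f x + g x)))
       \<le> (LINT x|lborel. cmod (f (x - X n) - f x) + cmod (g (x - X n) - g x))" for n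
    proof (rule integral_mono)
      fix x
      have "f (x - X n) + g (x - X n) - (f x + g x) = (f (x - X n) - f x) + (g (x - X n) - g x)" by simp
      then show "cmod (f (x - X n) + g (x - X n) - (f x + g x)) \<le> cmod (f (x - X n) - f x) + cmod (g (x - X n) - g x)"
        by (metis norm_triangle_ineq)
    qed (use i in auto)
    then show "\<forall>\<^sub>F n in sequentially. (LINT x|lborel. cmod (f (x - X n) + g (x - X n) - (f x + g x)))
       \<le> (LINT x|lborel. cmod (f (x - X n) - f x)) + (LINT x|lborel. cmod (g (x - X n) - g x))"
      using i by simp
    show "\<forall>\<^sub>F n in sequentially. 0 \<le> (LINT x|lborel. cmod (f (x - X n) + g (x - X n) - (f x + g x)))"
      by simp
  qed
next
  case (lim f s)
  have si: "integrable lborel (s i)" for i using lim.hyps by auto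
  have fi: "integrable lborel f" using lim.hyps by auto
  have slim: "(\<lambda>i. s i x) \<longlonglongrightarrow> f x" for x using lim.hyps by auto
  have sb: "cmod (s i x) \<le> 2 * cmod (f x)" for i x using lim.hyps by auto
  define w where "w v n = (LINT x|lborel. cmod (v (x - X n) - v x))" for v :: "real \<Rightarrow> complex" and n
  have "(\<lambda>i. LINT x|lborel. cmod (s i x - f x)) \<longlonglongrightarrow> (LINT x::real|lborel. (0::real))"
  proof (rule integral_dominated_convergence[where w="\<lambda>x. 3 * cmod (f x)"])
    have "(\<lambda>i. cmod (s i x - f x)) \<longlonglongrightarrow> 0" for x
      using slim[of x] by (simp add: tendsto_norm_zero_iff LIM_zero_iff)
    then show "AE x in lborel. (\<lambda>i. cmod (s i x - f x)) \<longlonglongrightarrow> 0" by simp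
    have "cmod (s i x - f x) \<le> 3 * cmod (f x)" for i x
      using sb[of i x] norm_triangle_ineq4[of "s i x" "f x"] by simp
    then show "AE x in lborel. norm (cmod (s i x - f x)) \<le> 3 * cmod (f x)" for i by simp
  qed (use si fi in \<open>auto dest: borel_measurable_integrable\<close>)
  then have L: "(\<lambda>i. LINT x|lborel. cmod (s i x - f x)) \<longlonglongrightarrow> 0" by simp
  have "w f \<longlonglongrightarrow> 0"
  proof (rule LIMSEQ_I)
    fix r :: real assume "r > 0"
    then obtain i where i: "(LINT x|lborel. cmod (s i x - f x)) < r/4"
      using order_tendstoD(2)[OF L, of "r/4"] by (auto dest: eventually_happens)
    obtain N where N: "\<And>n. n \<ge> N \<Longrightarrow> w (s i) n < r/2"
      using order_tendstoD(2)[OF lim.IH[of i], of "r/2"] \<open>r > 0\<close>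
      unfolding w_def eventually_sequentially by auto
    have "norm (w f n - 0) < r" if "n \<ge> N" for n
    proof -
      have id: "integrable lborel (\<lambda>x. cmod (s i x - f x))" using si fi by auto
      note ii = fi si[of i] integrable_shift[OF fi] integrable_shift[OF si[of i]] id
          integrable_shift[OF id]
      have "w f n \<le> (LINT x|lborel. cmod (s i (x - X n) - s i x)
              + (cmod (s i (x - X n) - f (x - X n)) + cmod (s i x - f x)))"
        unfolding w_def
      proof (rule integral_mono)
        fix x show "cmod (f (x - X n) - f x) \<le> cmod (s i (x - X n) - s i x)
              + (cmod (s i (x - X n) - f (x - X n)) + cmod (s i x - f x))"
          by norm
      qed (use ii in auto)
      also have "\<dots> = w (s i) n + ((LINT x|lborel. cmod (s i (x - X n) - f (x - X n))) + (LINT x|lborel. cmod (s i x - f x)))"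
        unfolding w_def using ii by simp
      also have "\<dots> = w (s i) n + 2 * (LINT x|lborel. cmod (s i x - f x))"
        using integral_shift[of "\<lambda>x. cmod (s i x - f x)" "X n"] by simp
      also have "\<dots> < r" using N[OF that] i by linarith
      finally have "w f n < r" .
      moreover have "w f n \<ge> 0" unfolding w_def by simp
      ultimately show ?thesis by simp
    qed
    then show "\<exists>no. \<forall>n\<ge>no. norm (w f n - 0) < r" by auto
  qed
  then show ?case unfolding w_def by simp
qed

section \<open>The Poisson kernel and the Cauchy transform\<close>

definition poisson :: "real \<Rightarrow> real \<Rightarrow> real" where
  "poisson y x = y / (pi * (x\<^sup>2 + y\<^sup>2))"

lemma poisson_nonneg: "y \<ge> 0 \<Longrightarrow> poisson y x \<ge> 0"
  by (simp add: poisson_def)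

lemma poisson_measurable [measurable]: "poisson y \<in> borel_measurable borel"
  unfolding poisson_def by measurable

lemma
  shows integrable_inverse_one_plus_square: "integrable lborel (\<lambda>x::real. inverse (1 + x\<^sup>2))"
    and integral_inverse_one_plus_square: "(LINT x|lborel. inverse (1 + x\<^sup>2)) = pi"
proof -
  have "einterval (-\<infinity>) \<infinity> = UNIV" by (auto simp: einterval_iff)
  then show "integrable lborel (\<lambda>x::real. inverse (1 + x\<^sup>2))"
    "(LINT x|lborel. inverse (1 + x\<^sup>2)) = pi"
    using integrable_inverse_1_plus_square LBINT_inverse_1_plus_square
    by (simp_all add: set_integrable_def interval_lebesgue_integral_def set_lebesgue_integral_def)
qed

lemma poisson_scale: "y > 0 \<Longrightarrow> poisson y (y * x) = poisson 1 x / y"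
proof -
  assume "y > 0"
  moreover have "(y * x)\<^sup>2 + y\<^sup>2 = y * (y * (x\<^sup>2 + 1))" by (simp add: power2_eq_square algebra_simps)
  ultimately show ?thesis by (simp add: poisson_def)
qed

lemma
  assumes "y > 0"
  shows integrable_poisson: "integrable lborel (poisson y)"
    and integral_poisson: "(LINT x|lborel. poisson y x) = 1"
proof -
  have 1: "poisson 1 = (\<lambda>x. inverse (1 + x\<^sup>2) / pi)"
    by (auto simp: poisson_def field_simps)
  have i1: "integrable lborel (poisson 1)" "(LINT x|lborel. poisson 1 x) = 1"
    unfolding 1 using integrable_inverse_one_plus_square integral_inverse_one_plus_square by auto
  have s: "(\<lambda>x. poisson y (0 + y * x)) = (\<lambda>x. poisson 1 x / y)"
    using poisson_scale[OF assms] by auto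
  show "integrable lborel (poisson y)"
    using lborel_integrable_real_affine_iff[of y "poisson y" 0] s i1 assms by simp
  show "(LINT x|lborel. poisson y x) = 1"
    using lborel_integral_real_affine[of y "poisson y" 0] s i1 assms by simp
qed

text \<open>Minkowski's integral inequality: an average of functions, with weights \<open>k s\<close>, has norm at most the average of
  their norms. It yields both the bound for a convolution and the speed at which a
  convolution with an approximate identity converges.\<close>

lemma minkowski_L1:
  fixes V :: "real \<Rightarrow> real \<Rightarrow> complex" and k m :: "real \<Rightarrow> real"
  assumes [measurable]: "(\<lambda>(s, x). V s x) \<in> borel_measurable (borel \<Otimes>\<^sub>M borel)"
    and k: "\<And>s. k s \<ge> 0" and [measurable]: "k \<in> borel_measurable borel"
    and V: "\<And>s. integrable lborel (V s)" "\<And>s. (LINT x|lborel. cmod (V s x)) \<le> m s"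
    and km: "integrable lborel (\<lambda>s. k s * m s)"
  shows "integrable lborel (\<lambda>x. LINT s|lborel. k s * V s x)"
    and "(LINT x|lborel. cmod (LINT s|lborel. k s * V s x)) \<le> (LINT s|lborel. k s * m s)"
proof -
  have [measurable]: "(\<lambda>(s, x). V s x) \<in> borel_measurable (lborel \<Otimes>\<^sub>M lborel)"
    by simp
  have [measurable]: "(\<lambda>x. LINT s|lborel. k s * V s x) \<in> borel_measurable borel"
    by measurable
  have m: "m s \<ge> 0" for s using V(2)[of s] by (rule order_trans[rotated]) simp
  have "(\<integral>\<^sup>+x. cmod (LINT s|lborel. k s * V s x) \<partial>lborel) \<le> (\<integral>\<^sup>+x. (\<integral>\<^sup>+s. k s * cmod (V s x) \<partial>lborel) \<partial>lborel)"
  proof (rule nn_integral_mono)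
    fix x
    have "ennreal (cmod (LINT s|lborel. k s * V s x)) \<le> (\<integral>\<^sup>+s. cmod (k s * V s x) \<partial>lborel)"
    proof (cases "integrable lborel (\<lambda>s. k s * V s x)")
      case True then show ?thesis by (rule integral_norm_bound_ennreal)
    qed (simp add: not_integrable_integral_eq)
    then show "ennreal (cmod (LINT s|lborel. k s * V s x)) \<le> (\<integral>\<^sup>+s. k s * cmod (V s x) \<partial>lborel)"
      using k by (simp add: norm_mult)
  qed
  also have "\<dots> = (\<integral>\<^sup>+s. (\<integral>\<^sup>+x. k s * cmod (V s x) \<partial>lborel) \<partial>lborel)"
    by (rule lborel_pair.Fubini') simp
  also have "\<dots> \<le> (\<integral>\<^sup>+s. k s * m s \<partial>lborel)"
  proof (rule nn_integral_mono)
    fix s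
    have [measurable]: "V s \<in> borel_measurable borel" using V(1)[of s] by auto
    have "(\<integral>\<^sup>+x. k s * cmod (V s x) \<partial>lborel) = k s * (\<integral>\<^sup>+x. cmod (V s x) \<partial>lborel)"
      using k by (simp add: ennreal_mult nn_integral_cmult)
    also have "\<dots> = k s * ennreal (LINT x|lborel. cmod (V s x))"
      using V(1) by (simp add: nn_integral_eq_integral)
    also have "\<dots> \<le> k s * ennreal (m s)" by (intro mult_left_mono ennreal_leI V) auto
    finally show "(\<integral>\<^sup>+x. k s * cmod (V s x) \<partial>lborel) \<le> ennreal (k s * m s)" using k m by (simp add: ennreal_mult)
  qed
  also have "\<dots> = ennreal (LINT s|lborel. k s * m s)"
    using km k m by (intro nn_integral_eq_integral) auto
  finally have *: "(\<integral>\<^sup>+x. cmod (LINT s|lborel. k s * V s x) \<partial>lborel) \<le> ennreal (LINT s|lborel. k s * m s)" .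
  show i: "integrable lborel (\<lambda>x. LINT s|lborel. k s * V s x)"
    using * by (intro integrableI_bounded) (auto simp: order.strict_trans1[OF *])
  have "ennreal (LINT x|lborel. cmod (LINT s|lborel. k s * V s x)) \<le> ennreal (LINT s|lborel. k s * m s)"
    using * by (subst nn_integral_eq_integral[symmetric]) (use i in auto)
  then show "(LINT x|lborel. cmod (LINT s|lborel. k s * V s x)) \<le> (LINT s|lborel. k s * m s)"
    by (subst (asm) ennreal_le_iff) (auto intro!: integral_nonneg_AE simp: k m)
qed

definition cauchy_transform :: "(real \<Rightarrow> complex) \<Rightarrow> complex \<Rightarrow> complex" where
  "cauchy_transform u z = (LINT t|lborel. u t / (complex_of_real t - z))"

lemma dist_real_ge_Im: "\<bar>Im z\<bar> \<le> cmod (complex_of_real t - z)"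
  using abs_Im_le_cmod[of "complex_of_real t - z"] by simp

lemma integrable_divide_bounded_below:
  fixes u q :: "real \<Rightarrow> complex"
  assumes "integrable lborel u" and [measurable]: "q \<in> borel_measurable borel"
    and "d > 0" "\<And>t. d \<le> cmod (q t)"
  shows "integrable lborel (\<lambda>t. u t / q t)"
proof (rule Bochner_Integration.integrable_bound[where f="\<lambda>t. cmod (u t) / d"])
  show "AE x in lborel. norm (u x / q x) \<le> norm (cmod (u x) / d)"
  proof (rule AE_I2)
    fix x
    have "0 < cmod (q x)" using assms(3) assms(4)[of x] by linarith
    then have "cmod (u x) / cmod (q x) \<le> cmod (u x) / d"
      using assms(3) assms(4)[of x] by (intro divide_left_mono mult_pos_pos) auto
    then show "norm (u x / q x) \<le> norm (cmod (u x) / d)" using assms(3) by (simp add: norm_divide)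
  qed
qed (use assms in auto)

text \<open>The difference quotient differs from the expected derivative by \<open>w - z\<close> times an integral that stays
  bounded as \<open>w\<close> tends to \<open>z\<close>, because the kernel keeps a positive distance from its pole.\<close>

lemma cauchy_transform_holomorphic:
  assumes u: "integrable lborel u"
  shows "cauchy_transform u holomorphic_on {z. Im z > 0}"
proof -
  have "(cauchy_transform u has_field_derivative (LINT t|lborel. u t / (complex_of_real t - z)^2)) (at z)"
    if "Im z > 0" for z
    unfolding has_field_derivative_iff
  proof (rule Lim_null_comparison[THEN LIM_zero_cancel])
    define d where "d = Im z / 2"
    have d: "d > 0" "Im z = 2 * d" using that by (auto simp: d_def)
    define K where "K = (LINT t|lborel. cmod (u t)) / d^3"
    show "eventually (\<lambda>w. norm ((cauchy_transform u w - cauchy_transform u z) / (w - z)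
        - (LINT t|lborel. u t / (complex_of_real t - z)^2)) \<le> cmod (w - z) * K) (at z)"
    proof -
      have "eventually (\<lambda>w. w \<in> ball z d \<and> w \<noteq> z) (at z)"
        using d by (auto simp: eventually_at_filter intro: eventually_nhds_in_open eventually_mono[OF eventually_nhds_in_open[of "ball z d" z]])
      then show ?thesis
      proof (rule eventually_mono)
        fix w assume w: "w \<in> ball z d \<and> w \<noteq> z"
        have "\<bar>Im z - Im w\<bar> < d"
          using w abs_Im_le_cmod[of "z - w"] by (simp add: dist_norm)
        then have Iw: "Im w \<ge> d" using d by linarith
        have wt: "d \<le> cmod (complex_of_real t - w)" for t using dist_real_ge_Im[of w t] Iw d by linarith
        have zt: "d \<le> cmod (complex_of_real t - z)" for t using dist_real_ge_Im[of z t] d by linarith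
        have nz: "complex_of_real t - w \<noteq> 0" "complex_of_real t - z \<noteq> 0" for t
          using wt[of t] zt[of t] d by auto
        have iw: "integrable lborel (\<lambda>t. u t / (complex_of_real t - w))"
          by (rule integrable_divide_bounded_below[OF u _ d(1) wt]) measurable
        have iz: "integrable lborel (\<lambda>t. u t / (complex_of_real t - z))"
          by (rule integrable_divide_bounded_below[OF u _ d(1) zt]) measurable
        have iz2: "integrable lborel (\<lambda>t. u t / (complex_of_real t - z)^2)"
          by (rule integrable_divide_bounded_below[OF u, of _ "d^2"])
            (use d zt in \<open>auto simp: norm_power intro!: power_mono\<close>)
        have q3: "d^3 \<le> cmod ((complex_of_real t - w) * (complex_of_real t - z)^2)" for t
        proof -
          have "d * d^2 \<le> cmod (complex_of_real t - w) * cmod (complex_of_real t - z)^2"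
            using d wt[of t] zt[of t] by (intro mult_mono power_mono) auto
          then show ?thesis by (simp add: norm_mult norm_power power3_eq_cube power2_eq_square mult_ac)
        qed
        have i3: "integrable lborel (\<lambda>t. u t / ((complex_of_real t - w) * (complex_of_real t - z)^2))"
          by (rule integrable_divide_bounded_below[OF u _ _ q3]) (use d in auto)
        have "(cauchy_transform u w - cauchy_transform u z) / (w - z)
            - (LINT t|lborel. u t / (complex_of_real t - z)^2)
           = (LINT t|lborel. (u t / (complex_of_real t - w) - u t / (complex_of_real t - z)) / (w - z) - u t / (complex_of_real t - z)^2)"
          unfolding cauchy_transform_def using iw iz iz2 by simp
        also have "\<dots> = (LINT t|lborel. (w - z) * (u t / ((complex_of_real t - w) * (complex_of_real t - z)^2)))"
        proof (rule Bochner_Integration.integral_cong[OF refl])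
          fix t
          have wz: "w - z \<noteq> 0" using w by auto
          show "(u t / (complex_of_real t - w) - u t / (complex_of_real t - z)) / (w - z) - u t / (complex_of_real t - z)^2
             = (w - z) * (u t / ((complex_of_real t - w) * (complex_of_real t - z)^2))"
            using nz[of t] wz by (simp add: divide_simps) (simp add: algebra_simps power2_eq_square)
        qed
        also have "\<dots> = (w - z) * (LINT t|lborel. (u t / ((complex_of_real t - w) * (complex_of_real t - z)^2)))"
          by (rule integral_mult_right_zero)
        finally have eq: "(cauchy_transform u w - cauchy_transform u z) / (w - z)
            - (LINT t|lborel. u t / (complex_of_real t - z)^2) = \<dots>" .
        have "cmod (LINT t|lborel. (u t / ((complex_of_real t - w) * (complex_of_real t - z)^2)))
          \<le> (LINT t|lborel. cmod (u t / ((complex_of_real t - w) * (complex_of_real t - z)^2)))"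
          by (rule integral_norm_bound)
        also have "\<dots> \<le> (LINT t|lborel. cmod (u t) / d^3)"
        proof (rule integral_mono)
          fix t show "cmod (u t / ((complex_of_real t - w) * (complex_of_real t - z)^2)) \<le> cmod (u t) / d^3"
            using q3[of t] d unfolding norm_divide
            by (intro divide_left_mono mult_pos_pos) (auto intro: less_le_trans)
        qed (use i3 u in auto)
        also have "\<dots> = K" by (simp add: K_def)
        finally show "norm ((cauchy_transform u w - cauchy_transform u z) / (w - z)
            - (LINT t|lborel. u t / (complex_of_real t - z)^2)) \<le> cmod (w - z) * K"
          unfolding eq norm_mult by (intro mult_left_mono) auto
      qed
    qed
    show "((\<lambda>w. cmod (w - z) * K) \<longlongrightarrow> 0) (at z)"
      by (auto intro!: tendsto_eq_intros)
  qed
  then show ?thesis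
    by (auto simp: holomorphic_on_def field_differentiable_def intro: has_field_derivative_at_within)
qed

lemma integral_exp_half_line:
  assumes "Re c > 0"
  shows "integrable lborel (\<lambda>s. indicat_real {0<..} s *\<^sub>R exp (- complex_of_real s * c))"
    and "(LINT s|lborel. indicat_real {0<..} s *\<^sub>R exp (- complex_of_real s * c)) = 1 / c"
proof -
  have eI: "einterval 0 \<infinity> = {0<..}" by (auto simp: einterval_iff zero_ereal_def)
  have [measurable]: "(\<lambda>s. indicat_real {0<..} s *\<^sub>R exp (- complex_of_real s * c)) \<in> borel_measurable borel"
    by measurable
  show int: "integrable lborel (\<lambda>s. indicat_real {0<..} s *\<^sub>R exp (- complex_of_real s * c))"
    using integrable_I0i_exp_mscale[OF assms] unfolding set_integrable_def
    by (rule Bochner_Integration.integrable_bound) auto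
  have nz: "c \<noteq> 0" using assms by auto
  have "(LBINT s=0..\<infinity>. exp (- complex_of_real s * c)) = 0 - (- 1 / c)"
  proof (rule interval_integral_FTC_integrable)
    show "((\<lambda>s. - exp (- complex_of_real s * c) / c) has_vector_derivative exp (- complex_of_real x * c)) (at x)" for x
    proof -
      have "((\<lambda>z. - exp (- z * c) / c) has_field_derivative exp (- complex_of_real x * c)) (at (complex_of_real x))"
        using nz by (auto intro!: derivative_eq_intros)
      from has_vector_derivative_real_field[OF this] show ?thesis by simp
    qed
    show "(((\<lambda>s. - exp (- complex_of_real s * c) / c) \<circ> real_of_ereal) \<longlongrightarrow> - 1 / c) (at_right 0)"
      unfolding zero_ereal_def ereal_tendsto_simps
      by (auto intro!: tendsto_eq_intros simp: nz)
    have "((\<lambda>s. exp (- (s * Re c)) / cmod c) \<longlongrightarrow> 0) at_top"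
    proof -
      have "((\<lambda>s. exp (- (s * Re c))) \<longlongrightarrow> 0) at_top"
        using assms
        by (auto intro!: exp_at_bot[THEN filterlim_compose] filterlim_at_top_mult_tendsto_pos[OF tendsto_const] filterlim_ident
             simp: filterlim_uminus_at_bot)
      from tendsto_divide[OF this tendsto_const[of "cmod c"]] show ?thesis using nz by auto
    qed
    then show "(((\<lambda>s. - exp (- complex_of_real s * c) / c) \<circ> real_of_ereal) \<longlongrightarrow> 0) (at_left \<infinity>)"
      unfolding ereal_tendsto_simps
      by (rule Lim_null_comparison[rotated]) (auto simp: norm_divide)
  qed (use int in \<open>auto simp: set_integrable_def eI\<close>)
  then show "(LINT s|lborel. indicat_real {0<..} s *\<^sub>R exp (- complex_of_real s * c)) = 1 / c"
    by (simp add: interval_lebesgue_integral_0_infty set_lebesgue_integral_def)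
qed

text \<open>Below the real axis the Cauchy kernel \<open>1 / (t - z)\<close> is a superposition of the exponentials \<open>exp(ist)\<close> with
  \<open>s > 0\<close>, against which \<open>u\<close> integrates to its Fourier coefficient at \<open>-s\<close>.\<close>

lemma cauchy_transform_lower_eq_0:
  assumes u: "integrable lborel u" and sp: "\<And>\<xi>. \<xi> < 0 \<Longrightarrow> fourier u \<xi> = 0" and z: "Im z < 0"
  shows "cauchy_transform u z = 0"
proof -
  have [measurable]: "u \<in> borel_measurable borel" using u by auto
  \<comment> \<open>Chosen so that \<open>exp(-s c(t)) = exp(is(t - z))\<close>, which decays in \<open>s\<close>.\<close>
  define c where "c t = - \<i> * (complex_of_real t - z)" for t :: real
  have Rc: "Re (c t) = - Im z" for t by (simp add: c_def)
  have c0: "complex_of_real t - z \<noteq> 0" for t using dist_real_ge_Im[of z t] z by auto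
  define E where "E = (\<lambda>(t, s). u t * (indicat_real {0<..} s *\<^sub>R exp (- complex_of_real s * c t)))"
  have [measurable]: "c \<in> borel_measurable borel" unfolding c_def by measurable
  have E[measurable]: "E \<in> borel_measurable (lborel \<Otimes>\<^sub>M lborel)"
    unfolding E_def by measurable
  have nE: "norm (E (t, s)) = cmod (u t) * (indicat_real {0<..} s *\<^sub>R exp (-(s * (- Im z))))" for t s
    by (auto simp: E_def norm_mult Rc indicator_def)
  have iE: "integrable (lborel \<Otimes>\<^sub>M lborel) E"
  proof (rule lborel_pair.Fubini_integrable[OF E])
    show "integrable lborel (\<lambda>t. LINT s|lborel. norm (E (t, s)))"
      unfolding nE integral_mult_right_zero by (intro integrable_mult_left integrable_norm u)
    have "integrable lborel (\<lambda>s. E (t, s))" for t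
      unfolding E_def prod.case
      by (intro integrable_mult_right integral_exp_half_line(1)) (use Rc z in simp)
    then show "AE t in lborel. integrable lborel (\<lambda>s. E (t, s))" by simp
  qed
  have "cauchy_transform u z = - \<i> * (LINT t|lborel. u t * (1 / c t))"
    unfolding cauchy_transform_def by (subst integral_mult_right_zero[symmetric])
      (intro Bochner_Integration.integral_cong, auto simp: c_def c0 divide_simps)
  also have "(LINT t|lborel. u t * (1 / c t)) = (LINT t|lborel. LINT s|lborel. E (t, s))"
    unfolding E_def prod.case integral_mult_right_zero
    by (subst integral_exp_half_line(2)) (use z Rc in auto)
  also have "\<dots> = (LINT s|lborel. LINT t|lborel. E (t, s))"
    using lborel_pair.Fubini_integral[of "\<lambda>t s. E (t, s)"] iE by simp
  also have "\<dots> = (LINT s::real|lborel. 0)"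
  proof (rule Bochner_Integration.integral_cong[OF refl])
    fix s
    show "(LINT t|lborel. E (t, s)) = 0"
    proof (cases "s > 0")
      case True
      have "(LINT t|lborel. E (t, s)) = (LINT t|lborel. exp (- \<i> * s * z) * (u t * exp (- \<i> * complex_of_real (t * (- s)))))"
        using True by (intro Bochner_Integration.integral_cong)
          (auto simp: E_def c_def exp_add[symmetric] algebra_simps)
      also have "\<dots> = exp (- \<i> * s * z) * fourier u (- s)" by (simp add: fourier_def)
      finally show ?thesis using sp[of "-s"] True by simp
    qed (simp add: E_def)
  qed
  finally show ?thesis by simp
qed

lemma poisson_cauchy:
  assumes "y > 0"
  shows "complex_of_real (poisson y (x - t)) =
     (1 / (complex_of_real t - Complex x y) - 1 / (complex_of_real t - Complex x (- y))) / (2 * pi * \<i>)"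
proof -
  have a: "complex_of_real t - Complex x y = Complex (t - x) (- y)"
          "complex_of_real t - Complex x (- y) = Complex (t - x) y"
    by (auto simp: complex_eq_iff)
  have b: "Complex (t - x) (- y) \<noteq> 0" "Complex (t - x) y \<noteq> 0"
    using assms by (auto simp: complex_eq_iff)
  have m: "Complex (t - x) (- y) * Complex (t - x) y = complex_of_real ((x - t)^2 + y^2)"
    by (auto simp: complex_eq_iff power2_eq_square algebra_simps)
  have "1 / Complex (t - x) (- y) - 1 / Complex (t - x) y = (Complex (t - x) y - Complex (t - x) (- y)) / complex_of_real ((x - t)^2 + y^2)"
    unfolding m[symmetric] using b by (simp add: divide_simps)
  also have "Complex (t - x) y - Complex (t - x) (- y) = 2 * \<i> * y" by (auto simp: complex_eq_iff)
  finally have e: "1 / Complex (t - x) (- y) - 1 / Complex (t - x) y = 2 * \<i> * y / complex_of_real ((x - t)^2 + y^2)" .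
  show ?thesis unfolding a e poisson_def by simp
qed

definition poisson_smoothing :: "real \<Rightarrow> (real \<Rightarrow> complex) \<Rightarrow> real \<Rightarrow> complex" where
  "poisson_smoothing y u x = (LINT s|lborel. complex_of_real (poisson y s) * u (x - s))"

lemma poisson_smoothing_alt:
  "poisson_smoothing y u x = (LINT t|lborel. complex_of_real (poisson y (x - t)) * u t)"
  unfolding poisson_smoothing_def
  using lborel_integral_real_affine[of "-1" "\<lambda>s. complex_of_real (poisson y s) * u (x - s)" x] by simp

lemma
  assumes u: "integrable lborel u" and "y > 0"
  shows integrable_poisson_smoothing: "integrable lborel (poisson_smoothing y u)"
    and L1_poisson_smoothing: "L1_norm (poisson_smoothing y u) \<le> L1_norm u"
proof -
  have [measurable]: "u \<in> borel_measurable borel" using u by auto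
  have 1: "(\<lambda>(s, x). u (x - s)) \<in> borel_measurable (borel \<Otimes>\<^sub>M borel)" by measurable
  have 2: "(LINT x|lborel. cmod (u (x - s))) \<le> L1_norm u" for s
    using integral_shift[of "\<lambda>x. cmod (u x)" s] by (simp add: L1_norm_def)
  have 3: "integrable lborel (\<lambda>s. poisson y s * L1_norm u)" using integrable_poisson[OF \<open>y > 0\<close>] by auto
  have 4: "poisson y s \<ge> 0" for s using \<open>y > 0\<close> by (intro poisson_nonneg) auto
  note M = minkowski_L1[OF 1 4 poisson_measurable integrable_shift[OF u] 2 3]
  show "integrable lborel (poisson_smoothing y u)"
    unfolding poisson_smoothing_def[abs_def] by (rule M(1))
  show "L1_norm (poisson_smoothing y u) \<le> L1_norm u"
    using M(2) integral_poisson[OF \<open>y > 0\<close>] by (simp add: L1_norm_def poisson_smoothing_def)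
qed

text \<open>The error is at most the average, over the Poisson kernel, of the norms of \<open>u(x - s) - u(x)\<close>. After rescaling
  to a fixed kernel, these norms tend to \<open>0\<close> by continuity of translations.\<close>

lemma poisson_smoothing_tendsto:
  assumes u: "integrable lborel u" and d: "\<And>n. d n > 0" "d \<longlonglongrightarrow> 0"
  shows "(\<lambda>n. L1_norm (\<lambda>x. poisson_smoothing (d n) u x - u x)) \<longlonglongrightarrow> 0"
proof -
  have [measurable]: "u \<in> borel_measurable borel" using u by auto
  define w where "w s = (LINT x|lborel. cmod (u (x - s) - u x))" for s
  have isd: "integrable lborel (\<lambda>x. u (x - s) - u x)" for s
    using u integrable_shift[OF u] by auto
  have [measurable]: "w \<in> borel_measurable borel" unfolding w_def by measurable
  have w0: "w s \<ge> 0" for s by (simp add: w_def)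
  have wb: "w s \<le> 2 * L1_norm u" for s
  proof -
    have "w s \<le> (LINT x|lborel. cmod (u (x - s)) + cmod (u x))"
      unfolding w_def using u integrable_shift[OF u] by (intro integral_mono) (auto simp: norm_triangle_ineq4)
    also have "\<dots> = (LINT x|lborel. cmod (u (x - s))) + (LINT x|lborel. cmod (u x))"
      using u integrable_shift[OF u] by simp
    also have "\<dots> = 2 * L1_norm u" using integral_shift[of "\<lambda>x. cmod (u x)" s] by (simp add: L1_norm_def)
    finally show ?thesis .
  qed
  have L0: "\<bar>L1_norm u\<bar> = L1_norm u" by (simp add: L1_norm_def)
  have ip: "integrable lborel (\<lambda>s. poisson y s * w s)" if "y > 0" for y
  proof (rule Bochner_Integration.integrable_bound[where f="\<lambda>s. poisson y s * (2 * L1_norm u)"])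
    have "norm (poisson y s * w s) \<le> norm (poisson y s * (2 * L1_norm u))" for s
      using mult_left_mono[OF wb[of s], of "poisson y s"] w0[of s] poisson_nonneg[of y s] that
      by (simp add: abs_mult L0)
    then show "AE s in lborel. norm (poisson y s * w s) \<le> norm (poisson y s * (2 * L1_norm u))" by simp
  qed (use integrable_poisson[OF that] in auto)
  have b: "L1_norm (\<lambda>x. poisson_smoothing y u x - u x) \<le> (LINT s|lborel. poisson 1 s * w (y * s))" if y: "y > 0" for y
  proof -
    have 1: "(\<lambda>(s, x). u (x - s) - u x) \<in> borel_measurable (borel \<Otimes>\<^sub>M borel)" by measurable
    have 4: "poisson y s \<ge> 0" for s using y by (intro poisson_nonneg) auto
    note M = minkowski_L1(2)[OF 1 4 poisson_measurable isd _ ip[OF y]]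
    have "AE x in lborel. cmod (poisson_smoothing y u x - u x) = cmod (LINT s|lborel. poisson y s * (u (x - s) - u x))"
    proof -
      \<comment> \<open>The convolution integral converges for almost every \<open>x\<close> only, by Tonelli; elsewhere it has the default value \<open>0\<close>.\<close>
      have "AE x in lborel. integrable lborel (\<lambda>s. complex_of_real (poisson y s) * u (x - s))"
      proof -
        have "(\<integral>\<^sup>+x. (\<integral>\<^sup>+s. ennreal (poisson y s * cmod (u (x - s))) \<partial>lborel) \<partial>lborel)
            = (\<integral>\<^sup>+s. (\<integral>\<^sup>+x. ennreal (poisson y s * cmod (u (x - s))) \<partial>lborel) \<partial>lborel)"
          by (rule lborel_pair.Fubini'[symmetric]) simp
        also have "\<dots> = (\<integral>\<^sup>+s. ennreal (poisson y s * L1_norm u) \<partial>lborel)"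
        proof (rule nn_integral_cong)
          fix s
          have "(\<integral>\<^sup>+x. ennreal (poisson y s * cmod (u (x - s))) \<partial>lborel) = poisson y s * (\<integral>\<^sup>+x. ennreal (cmod (u (x - s))) \<partial>lborel)"
            using 4 by (simp add: ennreal_mult nn_integral_cmult)
          also have "(\<integral>\<^sup>+x. ennreal (cmod (u (x - s))) \<partial>lborel) = (LINT x|lborel. cmod (u (x - s)))"
            using integrable_shift[OF u] by (intro nn_integral_eq_integral) auto
          also have "\<dots> = L1_norm u" using integral_shift[of "\<lambda>x. cmod (u x)" s] by (simp add: L1_norm_def)
          finally show "(\<integral>\<^sup>+x. ennreal (poisson y s * cmod (u (x - s))) \<partial>lborel) = ennreal (poisson y s * L1_norm u)"
            using 4 by (simp add: ennreal_mult L1_norm_def)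
        qed
        also have "\<dots> < \<infinity>"
          using integrable_poisson[OF y] 4 by (subst nn_integral_eq_integral) (auto simp: L1_norm_def)
        finally have "AE x in lborel. (\<integral>\<^sup>+s. ennreal (poisson y s * cmod (u (x - s))) \<partial>lborel) \<noteq> \<infinity>"
          by (intro nn_integral_PInf_AE) auto
        then show ?thesis
        proof (rule AE_mp, intro AE_I2 impI)
          fix x assume "(\<integral>\<^sup>+s. ennreal (poisson y s * cmod (u (x - s))) \<partial>lborel) \<noteq> \<infinity>"
          then show "integrable lborel (\<lambda>s. complex_of_real (poisson y s) * u (x - s))"
            using 4 by (intro integrableI_bounded) (auto simp: norm_mult top.not_eq_extremum)
        qed
      qed
      then show ?thesis
      proof (rule AE_mp, intro AE_I2 impI)
        fix x assume i: "integrable lborel (\<lambda>s. complex_of_real (poisson y s) * u (x - s))"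
        have "(LINT s|lborel. complex_of_real (poisson y s) * (u (x - s) - u x))
            = (LINT s|lborel. complex_of_real (poisson y s) * u (x - s)) - (LINT s|lborel. complex_of_real (poisson y s) * u x)"
          unfolding right_diff_distrib using i integrable_poisson[OF y] by (intro Bochner_Integration.integral_diff) auto
        also have "\<dots> = poisson_smoothing y u x - u x"
          using integral_poisson[OF y] by (simp add: poisson_smoothing_def)
        finally show "cmod (poisson_smoothing y u x - u x) = cmod (LINT s|lborel. poisson y s * (u (x - s) - u x))"
          by simp
      qed
    qed
    then have "L1_norm (\<lambda>x. poisson_smoothing y u x - u x) = (LINT x|lborel. cmod (LINT s|lborel. poisson y s * (u (x - s) - u x)))"
      unfolding L1_norm_def
      by (intro integral_cong_AE) (use u integrable_poisson_smoothing[OF u y] in \<open>auto\<close>)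
    also have "\<dots> \<le> (LINT s|lborel. poisson y s * w s)" using M by (simp add: w_def)
    also have "\<dots> = y * (LINT s|lborel. poisson y (y * s) * w (y * s))"
      using lborel_integral_real_affine[of y "\<lambda>s. poisson y s * w s" 0] y by simp
    also have "\<dots> = (LINT s|lborel. y * (poisson y (y * s) * w (y * s)))" by simp
    also have "(\<lambda>s. y * (poisson y (y * s) * w (y * s))) = (\<lambda>s. poisson 1 s * w (y * s))"
      using y by (simp add: poisson_scale)
    finally show ?thesis .
  qed
  have "(\<lambda>n. LINT s|lborel. poisson 1 s * w (d n * s)) \<longlonglongrightarrow> (LINT s::real|lborel. (0::real))"
  proof (rule integral_dominated_convergence[where w="\<lambda>s. poisson 1 s * (2 * L1_norm u)"])
    have "(\<lambda>n. poisson 1 s * w (d n * s)) \<longlonglongrightarrow> 0" for s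
    proof -
      have "(\<lambda>n. d n * s) \<longlonglongrightarrow> 0" using d(2) by (auto intro: tendsto_eq_intros)
      from translation_continuous_L1[OF u this] have "(\<lambda>n. w (d n * s)) \<longlonglongrightarrow> 0" by (simp add: w_def)
      then show ?thesis by (auto intro: tendsto_eq_intros)
    qed
    then show "AE s in lborel. (\<lambda>n. poisson 1 s * w (d n * s)) \<longlonglongrightarrow> 0" by simp
    show "AE s in lborel. norm (poisson 1 s * w (d n * s)) \<le> poisson 1 s * (2 * L1_norm u)" for n
      using w0 wb poisson_nonneg[of 1] by (auto simp: abs_mult intro!: mult_left_mono)
  qed (use integrable_poisson[of 1] in auto)
  then have l: "(\<lambda>n. LINT s|lborel. poisson 1 s * w (d n * s)) \<longlonglongrightarrow> 0" by simp
  show ?thesis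
    by (rule tendsto_sandwich[OF _ _ tendsto_const l]) (auto simp: L1_norm_def b[OF d(1), unfolded L1_norm_def])
qed

lemma poisson_smoothing_eq_cauchy:
  assumes u: "integrable lborel u" and sp: "\<And>\<xi>. \<xi> < 0 \<Longrightarrow> fourier u \<xi> = 0" and y: "y > 0"
  shows "poisson_smoothing y u x = cauchy_transform u (Complex x y) / (2 * pi * \<i>)"
proof -
  have i: "integrable lborel (\<lambda>t. u t / (complex_of_real t - z))" if "Im z \<noteq> 0" for z
    by (rule integrable_divide_bounded_below[OF u, of _ "\<bar>Im z\<bar>"]) (use that dist_real_ge_Im in auto)
  have "poisson_smoothing y u x = (LINT t|lborel. (u t / (complex_of_real t - Complex x y) - u t / (complex_of_real t - Complex x (- y))) / (2 * pi * \<i>))"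
    unfolding poisson_smoothing_alt poisson_cauchy[OF y]
    by (intro Bochner_Integration.integral_cong) (auto simp: field_simps)
  also have "\<dots> = (cauchy_transform u (Complex x y) - cauchy_transform u (Complex x (- y))) / (2 * pi * \<i>)"
    unfolding cauchy_transform_def using i[of "Complex x y"] i[of "Complex x (-y)"] y by simp
  also have "cauchy_transform u (Complex x (- y)) = 0"
    using y by (intro cauchy_transform_lower_eq_0[OF u sp]) auto
  finally show ?thesis by simp
qed

text \<open>By the preceding lemma the smoothing is the restriction of a translated Cauchy transform, which is
  holomorphic across the real axis. So the angular limits are just values of a continuous function, and the
  restrictions to horizontal lines are again Poisson smoothings, bounded by the norm of \<open>u\<close>.\<close>

lemma poisson_smoothing_in_H1:
  assumes u: "integrable lborel u" and sp: "\<And>\<xi>. \<xi> < 0 \<Longrightarrow> fourier u \<xi> = 0" and d: "d > 0"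
  shows "poisson_smoothing d u \<in> H1"
proof -
  define F where "F z = cauchy_transform u (z + \<i> * d) / (2 * pi * \<i>)" for z
  have hol: "F holomorphic_on {z. Im z > - d}"
  proof -
    have "(cauchy_transform u \<circ> (\<lambda>z. z + \<i> * d)) holomorphic_on {z. Im z > - d}"
      by (rule holomorphic_on_compose_gen[OF _ cauchy_transform_holomorphic[OF u]])
        (auto intro!: holomorphic_intros)
    then show ?thesis unfolding F_def by (auto intro!: holomorphic_intros simp: o_def)
  qed
  have Fy: "F (Complex x y) = poisson_smoothing (y + d) u x" if "y \<ge> 0" for x y
  proof -
    have e: "Complex x y + \<i> * complex_of_real d = Complex x (y + d)" by (simp add: complex_eq_iff)
    have "y + d > 0" using that d by simp
    then show ?thesis unfolding F_def e using poisson_smoothing_eq_cauchy[OF u sp] by simp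
  qed
  have "F \<in> hardy_space"
    unfolding hardy_space_def
  proof (intro CollectI conjI exI[of _ "L1_norm u"] allI impI)
    show "F holomorphic_on upper_half_plane"
      by (rule holomorphic_on_subset[OF hol]) (use d in \<open>auto simp: upper_half_plane_def\<close>)
    fix y :: real assume y: "y > 0"
    have e: "(\<lambda>x. F (Complex x y)) = poisson_smoothing (y + d) u" using Fy y by auto
    show "integrable lborel (\<lambda>x. F (Complex x y))" "L1_norm (\<lambda>x. F (Complex x y)) \<le> L1_norm u"
      unfolding e using y d integrable_poisson_smoothing[OF u] L1_poisson_smoothing[OF u] by auto
  qed
  moreover have "has_angular_limit F x (poisson_smoothing d u x)" for x
  proof -
    have "open {z. Im z > - d}" by (rule open_halfspace_Im_gt)
    then have "isCont F (complex_of_real x)"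
      using holomorphic_on_imp_continuous_on[OF hol] d by (intro continuous_on_interior[of "{z. Im z > - d}"]) (auto simp: interior_open)
    then have "(F \<longlongrightarrow> F (complex_of_real x)) (at (complex_of_real x) within S)" for S
      by (auto simp: isCont_def intro: tendsto_within_subset)
    moreover have "F (complex_of_real x) = poisson_smoothing d u x"
      using Fy[of 0 x] by (simp add: complex_of_real_def)
    ultimately show ?thesis by (simp add: has_angular_limit_def)
  qed
  ultimately show ?thesis
    unfolding H1_def using integrable_poisson_smoothing[OF u d] by auto
qed

section \<open>Integrals over horizontal lines\<close>

lemma has_contour_integral_horizontal:
  assumes "a < b"
  shows "(G has_contour_integral I) (linepath (Complex a y) (Complex b y))
     \<longleftrightarrow> ((\<lambda>x. G (Complex x y)) has_integral I) {a..b}"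
proof -
  let ?H = "\<lambda>z. G (z + \<i> * complex_of_real y)"
  have e: "Complex x y = complex_of_real x + \<i> * complex_of_real y" for x
    by (simp add: complex_eq_iff)
  have l: "linepath (Complex a y) (Complex b y) t = linepath (complex_of_real a) (complex_of_real b) t + \<i> * complex_of_real y" for t
    by (simp add: linepath_def e algebra_simps scaleR_conv_of_real)
  have d: "Complex b y - Complex a y = complex_of_real b - complex_of_real a" by (simp add: e)
  have "(G has_contour_integral I) (linepath (Complex a y) (Complex b y))
      \<longleftrightarrow> (?H has_contour_integral I) (linepath (complex_of_real a) (complex_of_real b))"
    unfolding has_contour_integral_linepath l d ..
  also have "\<dots> \<longleftrightarrow> ((\<lambda>x. ?H (complex_of_real x)) has_integral I) {a..b}"
    using assms by (subst has_contour_integral_linepath_Reals_iff) auto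
  finally show ?thesis by (simp add: e)
qed

lemma measurable_horizontal:
  assumes "continuous_on {z. Im z = y} G"
  shows "(\<lambda>x. G (Complex x y)) \<in> borel_measurable borel"
proof (rule borel_measurable_continuous_onI)
  have e: "(\<lambda>x. G (Complex x y)) = (\<lambda>x. G (complex_of_real x + \<i> * complex_of_real y))"
    by (intro ext arg_cong[where f=G]) (simp add: complex_eq_iff)
  show "continuous_on UNIV (\<lambda>x. G (Complex x y))"
    unfolding e by (rule continuous_on_compose2[OF assms]) (auto intro!: continuous_intros)
qed

lemma holomorphic_upper_continuous:
  assumes "G holomorphic_on upper_half_plane" "y > 0"
  shows "continuous_on {z. Im z \<ge> y} G"
  by (rule continuous_on_subset[OF holomorphic_on_imp_continuous_on[OF assms(1)]])
    (use assms(2) in \<open>auto simp: upper_half_plane_def\<close>)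

lemma convex_upper_half_plane: "convex upper_half_plane"
  unfolding upper_half_plane_def by (rule convex_halfspace_Im_gt)

lemma open_upper_half_plane: "open upper_half_plane"
  unfolding upper_half_plane_def by (rule open_halfspace_Im_gt)

lemma horizontal_measurable_holomorphic:
  assumes "G holomorphic_on upper_half_plane" "y > 0"
  shows "(\<lambda>x. G (Complex x y)) \<in> borel_measurable borel"
  by (rule measurable_horizontal, rule continuous_on_subset[OF holomorphic_upper_continuous[OF assms]]) auto

text \<open>The integral over a line is the common value of the integrals over large rectangles standing on it: by the
  quadratic decay, the other three sides contribute \<open>O(1/R)\<close>. Continuity is only asked for on the line and
  far away, so that \<open>G\<close> may have poles in between.\<close>

lemma line_integral_eq_rectangle:
  fixes G :: "complex \<Rightarrow> complex"
  assumes y: "y \<ge> 0" and cont: "continuous_on {z. Im z \<ge> y \<and> (Im z = y \<or> cmod z \<ge> \<rho>)} G"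
    and line: "\<And>x. cmod (G (Complex x y)) \<le> K * inverse (1 + x\<^sup>2)"
    and decay: "\<And>z. Im z \<ge> y \<Longrightarrow> cmod z \<ge> \<rho> \<Longrightarrow> cmod (G z) \<le> B / (cmod z)\<^sup>2"
    and rect: "\<And>R. R > 0 \<Longrightarrow> R \<ge> \<rho> \<Longrightarrow> (G has_contour_integral c) (rectpath (Complex (-R) y) (Complex R (y + R)))"
  shows "(LINT x|lborel. G (Complex x y)) = c"
proof -
  have [measurable]: "(\<lambda>x. G (Complex x y)) \<in> borel_measurable borel"
    by (rule measurable_horizontal, rule continuous_on_subset[OF cont]) auto
  have iK: "integrable lborel (\<lambda>x::real. K * inverse (1 + x\<^sup>2))"
    using integrable_inverse_one_plus_square by (rule integrable_mult_right)
  have int: "integrable lborel (\<lambda>x. G (Complex x y))"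
    by (rule Bochner_Integration.integrable_bound[OF iK]) (auto intro!: AE_I2 order_trans[OF line])
  define I where "I n = (LINT x|lborel. indicat_real {- real n..real n} x *\<^sub>R G (Complex x y))" for n :: nat
  have "I \<longlonglongrightarrow> (LINT x|lborel. G (Complex x y))"
    unfolding I_def
  proof (rule integral_dominated_convergence[where w="\<lambda>x. cmod (G (Complex x y))"])
    have "(\<lambda>n. indicat_real {- real n..real n} x *\<^sub>R G (Complex x y)) \<longlonglongrightarrow> G (Complex x y)" for x
    proof (rule tendsto_eventually)
      show "eventually (\<lambda>n. indicat_real {- real n..real n} x *\<^sub>R G (Complex x y) = G (Complex x y)) sequentially"
        using eventually_ge_at_top[of "nat \<lceil>\<bar>x\<bar>\<rceil>"]
      proof eventually_elim
        case (elim n)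
        then have "\<bar>x\<bar> \<le> real n" by linarith
        then show ?case by (simp add: indicator_def abs_le_iff)
      qed
    qed
    then show "AE x in lborel. (\<lambda>n. indicat_real {- real n..real n} x *\<^sub>R G (Complex x y)) \<longlonglongrightarrow> G (Complex x y)" by simp
  qed (use int in \<open>auto simp: indicator_def\<close>)
  moreover have "I \<longlonglongrightarrow> c"
  proof -
    define n0 where "n0 = nat \<lceil>\<rho>\<rceil> + 1"
    have bound: "cmod (I n - c) \<le> 4 * \<bar>B\<bar> / real n" if n: "n \<ge> n0" for n
    proof -
      define R where "R = real n"
      have R: "R > 0" "R \<ge> \<rho>" using n unfolding R_def n0_def by linarith+
      let ?a = "Complex (-R) y" and ?b = "Complex R y" and ?c = "Complex R (y+R)" and ?d = "Complex (-R) (y+R)"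
      have ci: "G contour_integrable_on linepath p q"
        if "\<And>z. z \<in> closed_segment p q \<Longrightarrow> Im z \<ge> y \<and> (Im z = y \<or> cmod z \<ge> R)" for p q
        using that R by (intro contour_integrable_continuous_linepath continuous_on_subset[OF cont]) fastforce
      have Bn: "cmod (G z) \<le> \<bar>B\<bar> / R\<^sup>2" if "Im z \<ge> y" "cmod z \<ge> R" for z
      proof -
        have "cmod (G z) \<le> B / (cmod z)\<^sup>2" using decay that R by auto
        also have "\<dots> \<le> \<bar>B\<bar> / (cmod z)\<^sup>2" by (intro divide_right_mono) auto
        also have "\<dots> \<le> \<bar>B\<bar> / R\<^sup>2" using that R
          by (intro divide_left_mono power_mono mult_pos_pos) (auto intro!: zero_less_power)
        finally show ?thesis .
      qed
      have seg: "cmod (contour_integral (linepath p q) G) \<le> \<bar>B\<bar> / R\<^sup>2 * cmod (q - p)"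
        if "\<And>z. z \<in> closed_segment p q \<Longrightarrow> Im z \<ge> y \<and> cmod z \<ge> R" for p q
        by (rule contour_integral_bound_linepath) (use that Bn in \<open>auto intro!: ci\<close>)
      have ab: "Im z \<ge> y \<and> (Im z = y \<or> cmod z \<ge> R)" if "z \<in> closed_segment ?a ?b" for z
        using that closed_segment_same_Im[of ?a ?b] by auto
      have bc: "Im z \<ge> y \<and> cmod z \<ge> R" if "z \<in> closed_segment ?b ?c" for z
        using that R closed_segment_same_Re[of ?b ?c] abs_Re_le_cmod[of z]
        by (auto simp: closed_segment_eq_real_ivl)
      have cd: "Im z \<ge> y \<and> cmod z \<ge> R" if "z \<in> closed_segment ?c ?d" for z
        using that R y closed_segment_same_Im[of ?c ?d] abs_Im_le_cmod[of z] by auto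
      have da: "Im z \<ge> y \<and> cmod z \<ge> R" if "z \<in> closed_segment ?d ?a" for z
        using that R closed_segment_same_Re[of ?d ?a] abs_Re_le_cmod[of z]
        by (auto simp: closed_segment_eq_real_ivl)
      have s1: "cmod (contour_integral (linepath ?b ?c) G) \<le> \<bar>B\<bar> / R\<^sup>2 * R"
        using seg[of ?b ?c, OF bc] R by (simp add: cmod_eq_Im)
      have s2: "cmod (contour_integral (linepath ?c ?d) G) \<le> \<bar>B\<bar> / R\<^sup>2 * (2 * R)"
        using seg[of ?c ?d, OF cd] R by (simp add: cmod_eq_Re)
      have s3: "cmod (contour_integral (linepath ?d ?a) G) \<le> \<bar>B\<bar> / R\<^sup>2 * R"
        using seg[of ?d ?a, OF da] R by (simp add: cmod_eq_Im)
      have I: "contour_integral (linepath ?a ?b) G = I n"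
      proof -
        have si: "set_integrable lborel {-R..R} (\<lambda>x. G (Complex x y))"
          unfolding set_integrable_def
          by (rule Bochner_Integration.integrable_bound[OF int]) (auto simp: indicator_def)
        have "((\<lambda>x. G (Complex x y)) has_integral (LINT x:{-R..R}|lborel. G (Complex x y))) {-R..R}"
          using has_integral_set_lebesgue[OF _ ] set_borel_integral_eq_integral[OF si] by (simp add: has_integral_iff)
        then have "(G has_contour_integral (LINT x:{-R..R}|lborel. G (Complex x y))) (linepath ?a ?b)"
          using R by (subst has_contour_integral_horizontal) auto
        then show ?thesis by (simp add: contour_integral_unique I_def set_lebesgue_integral_def R_def)
      qed
      have "c = contour_integral (rectpath ?a ?c) G"
        using rect[OF R] by (simp add: contour_integral_unique)
      also have "\<dots> = contour_integral (linepath ?a ?b) G + (contour_integral (linepath ?b ?c) G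
           + (contour_integral (linepath ?c ?d) G + contour_integral (linepath ?d ?a) G))"
      proof -
        have "G contour_integrable_on linepath ?a ?b" "G contour_integrable_on linepath ?b ?c"
          "G contour_integrable_on linepath ?c ?d" "G contour_integrable_on linepath ?d ?a"
          using ab bc cd da by (auto intro!: ci)
        then show ?thesis unfolding rectpath_def Let_def
          by (simp add: contour_integrable_joinI valid_path_join)
      qed
      finally have c: "I n - c = - (contour_integral (linepath ?b ?c) G
           + (contour_integral (linepath ?c ?d) G + contour_integral (linepath ?d ?a) G))"
        unfolding I by simp
      have "cmod (I n - c) \<le> \<bar>B\<bar> / R\<^sup>2 * R + (\<bar>B\<bar> / R\<^sup>2 * (2 * R) + \<bar>B\<bar> / R\<^sup>2 * R)"
        unfolding c norm_minus_cancel by (intro norm_triangle_le add_mono s1 s2 s3)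
      also have "\<dots> = 4 * \<bar>B\<bar> / real n"
        using R by (simp add: R_def[symmetric] field_simps power2_eq_square)
      finally show ?thesis .
    qed
    have "(\<lambda>n. I n - c) \<longlonglongrightarrow> 0"
    proof (rule Lim_null_comparison)
      show "eventually (\<lambda>n. norm (I n - c) \<le> 4 * \<bar>B\<bar> / real n) sequentially"
        using eventually_ge_at_top[of n0] by eventually_elim (rule bound)
      show "(\<lambda>n. 4 * \<bar>B\<bar> / real n) \<longlonglongrightarrow> 0" by (rule lim_const_over_n)
    qed
    then show ?thesis by (rule LIM_zero_cancel)
  qed
  ultimately show ?thesis by (rule LIMSEQ_unique)
qed

lemma line_integral_eq_0:
  fixes G :: "complex \<Rightarrow> complex"
  assumes hol: "G holomorphic_on upper_half_plane" and y: "y > 0"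
    and line: "\<And>x. cmod (G (Complex x y)) \<le> K * inverse (1 + x\<^sup>2)"
    and decay: "\<And>z. Im z \<ge> y \<Longrightarrow> cmod (G z) \<le> B / (cmod z)\<^sup>2"
  shows "(LINT x|lborel. G (Complex x y)) = 0"
proof (rule line_integral_eq_rectangle[where \<rho>=0, OF _ _ line decay])
  show "continuous_on {z. Im z \<ge> y \<and> (Im z = y \<or> cmod z \<ge> 0)} G"
    by (rule continuous_on_subset[OF holomorphic_upper_continuous[OF hol y]]) auto
  fix R :: real assume R: "R > 0"
  have "path_image (rectpath (Complex (-R) y) (Complex R (y + R))) \<subseteq> cbox (Complex (-R) y) (Complex R (y + R))"
    using R by (intro path_image_rectpath_subset_cbox) auto
  also have "\<dots> \<subseteq> upper_half_plane" using y by (auto simp: in_cbox_complex_iff upper_half_plane_def)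
  finally show "(G has_contour_integral 0) (rectpath (Complex (-R) y) (Complex R (y + R)))"
    by (intro Cauchy_theorem_convex_simple[OF hol convex_upper_half_plane]) auto
qed (use y in auto)

text \<open>Dividing \<open>K\<close> by \<open>(z - iy)\<^sup>2 + 1\<close> gives decay, and on the line \<open>Im z = y\<close> this denominator is \<open>1 + x\<^sup>2\<close>.
  Its only zero above that line is \<open>p = i(y + 1)\<close>, so that Cauchy's integral formula evaluates the integral.\<close>

lemma poisson_formula_bounded:
  fixes K :: "complex \<Rightarrow> complex" and y :: real
  assumes hol: "K holomorphic_on upper_half_plane" and b: "\<And>z. Im z > 0 \<Longrightarrow> cmod (K z) \<le> 1" and y: "y > 0"
  shows "(LINT x|lborel. K (Complex x y) * complex_of_real (inverse (1 + x\<^sup>2))) = pi * K (\<i> * complex_of_real (1 + y))"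
proof -
  define p q where "p = \<i> * complex_of_real (y + 1)" and "q = \<i> * complex_of_real (y - 1)"
  define G where "G z = K z / (z - q) / (z - p)" for z
  \<comment> \<open>A convex domain that contains the rectangles and the zero \<open>p\<close> of the denominator but not the zero \<open>q\<close>.\<close>
  define S where "S = upper_half_plane \<inter> {z. Im z > y - 1}"
  have S: "convex S" "open S" "S \<subseteq> upper_half_plane" "q \<notin> S" "p \<in> S"
    using y convex_upper_half_plane open_upper_half_plane unfolding S_def
    by (auto simp: convex_Int convex_halfspace_Im_gt open_Int open_halfspace_Im_gt p_def q_def upper_half_plane_def)
  have f: "(\<lambda>z. K z / (z - q)) holomorphic_on S"
    using S by (intro holomorphic_intros holomorphic_on_subset[OF hol]) auto
  have contK: "continuous_on {z. Im z \<ge> y} K" by (rule holomorphic_upper_continuous[OF hol y])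
  have lineG: "G (Complex x y) = K (Complex x y) * complex_of_real (inverse (1 + x\<^sup>2))" for x
  proof -
    have "(Complex x y - q) * (Complex x y - p) = complex_of_real (1 + x\<^sup>2)"
      by (simp add: complex_eq_iff p_def q_def power2_eq_square)
    then show ?thesis by (simp add: G_def divide_inverse mult.assoc flip: inverse_mult_distrib)
  qed
  have contG: "continuous_on ({z. Im z \<ge> y} - {p}) G"
    unfolding G_def using y
    by (intro continuous_intros continuous_on_subset[OF contK]) (auto simp: q_def)
  define \<rho> where "\<rho> = 2 * (y + 2)"
  have far: "cmod (z - q) \<ge> cmod z / 2" "cmod (z - p) \<ge> cmod z / 2" if "cmod z \<ge> \<rho>" for z
  proof -
    have "cmod p = y + 1" "cmod q \<le> y + 1"
      unfolding p_def q_def norm_mult norm_of_real using y by auto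
    note b = this norm_triangle_ineq2[of z p] norm_triangle_ineq2[of z q] that[unfolded \<rho>_def]
    have a: "a / 2 \<le> t" if "a - c \<le> t" "c \<le> y + 1" "2 * (y + 2) \<le> a" for a c t :: real
      using that by (simp add: field_simps)
    show "cmod (z - q) \<ge> cmod z / 2" by (rule a[OF b(4,2,5)])
    show "cmod (z - p) \<ge> cmod z / 2" using b(1) by (intro a[OF b(3) _ b(5)]) simp
  qed
  have "(LINT x|lborel. G (Complex x y)) = pi * K p"
  proof (rule line_integral_eq_rectangle[where \<rho>=\<rho>])
    have "cmod p < \<rho>" using y by (simp add: \<rho>_def p_def norm_mult)
    then show "continuous_on {z. Im z \<ge> y \<and> (Im z = y \<or> cmod z \<ge> \<rho>)} G"
      by (intro continuous_on_subset[OF contG]) (auto simp: p_def)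
    show "cmod (G (Complex x y)) \<le> 1 * inverse (1 + x\<^sup>2)" for x
    proof -
      have "cmod (G (Complex x y)) = cmod (K (Complex x y)) * inverse (1 + x\<^sup>2)"
        unfolding lineG norm_mult norm_of_real by simp
      then show ?thesis using b[of "Complex x y"] y by (simp add: mult_left_le_one_le divide_right_mono)
    qed
    show "cmod (G z) \<le> 4 / (cmod z)\<^sup>2" if "Im z \<ge> y" "cmod z \<ge> \<rho>" for z
    proof -
      have z: "cmod z > 0" by (rule less_le_trans[OF _ that(2)]) (use y in \<open>simp add: \<rho>_def\<close>)
      have "cmod (G z) = cmod (K z) / (cmod (z - q) * cmod (z - p))" by (simp add: G_def norm_divide norm_mult)
      also have "\<dots> \<le> 1 / (cmod z / 2 * (cmod z / 2))"
        using that y b[of z] z far[OF that(2)] by (intro frac_le mult_mono mult_pos_pos) auto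
      finally show ?thesis by (simp add: power2_eq_square)
    qed
    fix R assume R: "R > 0" "R \<ge> \<rho>"
    let ?r = "rectpath (Complex (-R) y) (Complex R (y + R))"
    have pb: "p \<in> box (Complex (-R) y) (Complex R (y + R))"
      using R y by (auto simp: in_box_complex_iff p_def \<rho>_def)
    have "path_image ?r \<subseteq> cbox (Complex (-R) y) (Complex R (y + R))"
      using R by (intro path_image_rectpath_subset_cbox) auto
    also have "\<dots> \<subseteq> S" using y by (auto simp: S_def in_cbox_complex_iff upper_half_plane_def)
    finally have "path_image ?r \<subseteq> S" .
    moreover have "path_image ?r \<inter> box (Complex (-R) y) (Complex R (y + R)) = {}"
      using R by (intro path_image_rectpath_inter_box) auto
    ultimately have sub: "path_image ?r \<subseteq> S - {p}" using pb by auto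
    have "((\<lambda>w. K w / (w - q) / (w - p)) has_contour_integral (2 * pi * \<i> * winding_number ?r p * (K p / (p - q)))) ?r"
      by (rule Cauchy_integral_formula_convex_simple[OF S(1) f])
        (use S sub in \<open>auto simp: interior_open\<close>)
    moreover have "p - q = 2 * \<i>" by (simp add: p_def q_def algebra_simps)
    ultimately show "(G has_contour_integral pi * K p) ?r"
      by (simp add: winding_number_rectpath[OF pb] G_def[abs_def])
  qed (use y in auto)
  then show ?thesis unfolding lineG by (simp add: p_def add.commute)
qed

text \<open>Integrability on horizontal lines bounds the increments of a primitive of \<open>F\<close> by \<open>C\<close>, uniformly in the upper
  half-plane. Cauchy's inequality for the derivative of these increments then bounds the differences
  \<open>F(z + s) - F(z)\<close>, and \<open>F(z + s)\<close> is small for some \<open>s\<close>.\<close>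

lemma hardy_space_bound:
  assumes hol: "F holomorphic_on upper_half_plane"
    and int: "\<And>y. y > 0 \<Longrightarrow> integrable lborel (\<lambda>x. F (Complex x y))"
    and C: "\<And>y. y > 0 \<Longrightarrow> L1_norm (\<lambda>x. F (Complex x y)) \<le> C"
    and z: "Im z > 0"
  shows "cmod (F z) \<le> 1 + 2 * C / Im z"
proof -
  obtain P where P: "\<And>w. w \<in> upper_half_plane \<Longrightarrow> (P has_field_derivative F w) (at w within upper_half_plane)"
    using holomorphic_convex_primitive'[OF convex_upper_half_plane open_upper_half_plane hol] by blast
  have P': "(P has_field_derivative F w) (at w)" if "Im w > 0" for w
    using P[of w] that at_within_open[OF _ open_upper_half_plane, of w] by (simp add: upper_half_plane_def)
  have inc: "cmod (P (w + complex_of_real s) - P w) \<le> C" if w: "Im w > 0" and s: "s > 0" for w s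
  proof -
    define x y where "x = Re w" and "y = Im w"
    have e: "Complex x y = w" "Complex (x + s) y = w + complex_of_real s"
      by (auto simp: complex_eq_iff x_def y_def)
    have y: "y > 0" using w by (simp add: y_def)
    have sub: "path_image (linepath (Complex x y) (Complex (x + s) y)) \<subseteq> upper_half_plane"
      unfolding path_image_linepath using y
      by (intro closed_segment_subset convex_upper_half_plane) (auto simp: upper_half_plane_def)
    have "(F has_contour_integral (P (Complex (x + s) y) - P (Complex x y))) (linepath (Complex x y) (Complex (x + s) y))"
      using contour_integral_primitive[OF P valid_path_linepath sub] by simp
    then have hi: "((\<lambda>t. F (Complex t y)) has_integral (P (Complex (x + s) y) - P (Complex x y))) {x..x + s}"
      using s by (subst (asm) has_contour_integral_horizontal) auto
    have si: "set_integrable lborel {x..x + s} (\<lambda>t. F (Complex t y))"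
      unfolding set_integrable_def using int[OF y]
      by (rule Bochner_Integration.integrable_bound) (use int[OF y] in \<open>auto simp: indicator_def\<close>)
    have "P (Complex (x + s) y) - P (Complex x y) = (LINT t:{x..x + s}|lborel. F (Complex t y))"
      using hi set_borel_integral_eq_integral(2)[OF si] by (simp add: integral_unique)
    also have "cmod \<dots> \<le> (LINT t|lborel. cmod (indicat_real {x..x + s} t *\<^sub>R F (Complex t y)))"
      unfolding set_lebesgue_integral_def by (rule integral_norm_bound)
    also have "\<dots> \<le> (LINT t|lborel. cmod (F (Complex t y)))"
      using integrable_norm[OF si[unfolded set_integrable_def]] integrable_norm[OF int[OF y]]
      by (rule integral_mono) (auto simp: indicator_def)
    also have "\<dots> \<le> C" using C[OF y] by (simp add: L1_norm_def)
    finally show ?thesis unfolding e .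
  qed
  define r where "r = Im z / 2"
  have r: "r > 0" using z by (simp add: r_def)
  have ballpos: "Im w > 0" if "w \<in> cball z r" for w
    using that abs_Im_le_cmod[of "z - w"] z by (auto simp: dist_norm r_def)
  have diff: "cmod (F (z + complex_of_real s) - F z) \<le> C / r" if s: "s > 0" for s
  proof -
    define D where "D w = P (w + complex_of_real s) - P w" for w
    have D': "(D has_field_derivative F (w + complex_of_real s) - F w) (at w)" if "Im w > 0" for w
    proof -
      have "((\<lambda>w. P (w + complex_of_real s)) has_field_derivative F (w + complex_of_real s)) (at w)"
        using P'[of "w + complex_of_real s"] that by (subst DERIV_shift[symmetric]) (auto simp: add.commute)
      from DERIV_diff[OF this P'[OF that]] show ?thesis unfolding D_def .
    qed
    have "cmod ((deriv ^^ 1) D z) \<le> fact 1 * C / r ^ 1"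
    proof (rule Cauchy_inequality)
      show "continuous_on (cball z r) D"
        using DERIV_isCont[OF D'[OF ballpos]] by (intro continuous_at_imp_continuous_on ballI)
      show "D holomorphic_on ball z r"
      proof (rule holomorphic_onI)
        fix w assume "w \<in> ball z r"
        then have "Im w > 0" by (intro ballpos) auto
        from has_field_derivative_at_within[OF D'[OF this]]
        show "D field_differentiable at w within ball z r" unfolding field_differentiable_def by blast
      qed
      show "cmod (D w) \<le> C" if "cmod (z - w) = r" for w
        unfolding D_def using that ballpos[of w] by (intro inc s) (auto simp: dist_norm)
    qed (rule r)
    then show ?thesis using DERIV_imp_deriv[OF D'[OF z]] by simp
  qed
  \<comment> \<open>The function is small somewhere to the right, as it is integrable.\<close>
  have "\<exists>s>0. cmod (F (z + complex_of_real s)) \<le> 1"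
  proof (rule ccontr)
    assume neg: "\<not> ?thesis"
    define x y where "x = Re z" and "y = Im z"
    have big: "cmod (F (Complex t y)) > 1" if "t > x" for t
    proof -
      have "Complex t y = z + complex_of_real (t - x)" by (simp add: complex_eq_iff x_def y_def)
      moreover have "\<not> cmod (F (z + complex_of_real (t - x))) \<le> 1"
        using neg diff_gt_0_iff_gt[THEN iffD2, OF that] by blast
      ultimately show ?thesis by simp
    qed
    have y: "y > 0" using z by (simp add: y_def)
    have C0: "C \<ge> 0" using C[OF y] order_trans[of 0 "L1_norm (\<lambda>x. F (Complex x y))" C] by (simp add: L1_norm_def)
    have "C + 1 = (LINT t|lborel. indicat_real {x<..x + (C + 1)} t)" using C0 by simp
    also have "\<dots> \<le> (LINT t|lborel. cmod (F (Complex t y)))"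
    proof (rule integral_mono)
      show "integrable lborel (indicat_real {x<..x + (C + 1)})"
        using C0 by (intro integrable_real_indicator) auto
      show "indicat_real {x<..x + (C + 1)} t \<le> cmod (F (Complex t y))" for t
        using big[of t] by (auto simp: indicator_def)
    qed (use int[OF y] in auto)
    also have "\<dots> \<le> C" using C[OF y] by (simp add: L1_norm_def)
    finally show False by simp
  qed
  then obtain s where s: "s > 0" "cmod (F (z + complex_of_real s)) \<le> 1" by blast
  have "cmod (F z) \<le> cmod (F (z + complex_of_real s)) + cmod (F (z + complex_of_real s) - F z)"
    using norm_triangle_sub[of "F z" "F (z + complex_of_real s)"] by (simp add: norm_minus_commute)
  also have "\<dots> \<le> 1 + C / r" by (intro add_mono s diff)
  finally show ?thesis by (simp add: r_def mult.commute)
qed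

section \<open>Bounded holomorphic functions suppressing a small set\<close>

text \<open>The holomorphic function whose real part is the Poisson integral of the indicator of \<open>U\<close>. The
  Herglotz kernel \<open>(1 + tz) / ((t - z)(1 + t\<^sup>2))\<close> is split by \<open>1 + tz = (1 + z\<^sup>2) + z(t - z)\<close>, which makes sense of
  the integral for sets \<open>U\<close> of infinite measure and expresses it by a Cauchy transform.\<close>

definition herglotz :: "real set \<Rightarrow> complex \<Rightarrow> complex" where
  "herglotz U z = - \<i> / pi * ((1 + z\<^sup>2) * cauchy_transform (\<lambda>t. indicat_real U t * inverse (1 + t\<^sup>2)) z
      + z * (LINT t|lborel. indicat_real U t * inverse (1 + t\<^sup>2)))"

lemma integrable_indicator_one_plus_square:
  assumes [measurable]: "U \<in> sets borel"
  shows "integrable lborel (\<lambda>t::real. indicat_real U t * inverse (1 + t\<^sup>2))"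
  by (rule Bochner_Integration.integrable_bound[OF integrable_inverse_one_plus_square])
    (auto simp: indicator_def)

lemma herglotz_holomorphic:
  assumes "U \<in> sets borel"
  shows "herglotz U holomorphic_on upper_half_plane"
  unfolding herglotz_def[abs_def] upper_half_plane_def
  by (intro holomorphic_intros cauchy_transform_holomorphic integrable_of_real integrable_indicator_one_plus_square assms)
    auto

lemma herglotz_i:
  "herglotz U \<i> = (LINT t|lborel. indicat_real U t * inverse (1 + t\<^sup>2)) / pi"
  by (simp add: herglotz_def)

lemma Re_herglotz_kernel:
  assumes y: "y > 0"
  shows "Re (- \<i> / pi * ((1 + (Complex x y)\<^sup>2) * (complex_of_real (inverse (1 + t\<^sup>2)) / (complex_of_real t - Complex x y))
      + Complex x y * complex_of_real (inverse (1 + t\<^sup>2)))) = poisson y (x - t)"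
proof -
  define z where "z = Complex x y"
  define N where "N = (x - t)\<^sup>2 + y\<^sup>2"
  define r where "r = inverse (1 + t\<^sup>2)"
  have N: "N > 0" unfolding N_def using y by (intro add_nonneg_pos) auto
  have t: "1 + t\<^sup>2 \<noteq> 0" using add_pos_nonneg[of 1 "t\<^sup>2"] by simp
  have tz: "complex_of_real t - z \<noteq> 0" using y by (auto simp: z_def complex_eq_iff)
  have inv: "1 / (complex_of_real t - z) = cnj (complex_of_real t - z) / complex_of_real N"
  proof -
    have "(complex_of_real t - z) * cnj (complex_of_real t - z) = complex_of_real N"
      by (simp add: complex_eq_iff z_def N_def power2_eq_square algebra_simps)
    then show ?thesis using tz N by (simp add: frac_eq_eq mult.commute)
  qed
  have "(1 + z\<^sup>2) * (complex_of_real r / (complex_of_real t - z)) + z * complex_of_real r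
     = ((1 + z\<^sup>2 + z * (complex_of_real t - z)) / (complex_of_real t - z)) * complex_of_real r"
    using tz by (simp add: add_divide_distrib distrib_right)
  also have "1 + z\<^sup>2 + z * (complex_of_real t - z) = 1 + complex_of_real t * z"
    by (simp add: algebra_simps power2_eq_square)
  also have "(1 + complex_of_real t * z) / (complex_of_real t - z)
     = (1 + complex_of_real t * z) * cnj (complex_of_real t - z) / complex_of_real N"
    using inv by (metis mult.right_neutral times_divide_eq_right)
  finally have e: "(1 + z\<^sup>2) * (complex_of_real r / (complex_of_real t - z)) + z * complex_of_real r
     = (1 + complex_of_real t * z) * cnj (complex_of_real t - z) / complex_of_real N * complex_of_real r" .
  have Re_i: "Re (- \<i> / complex_of_real pi * w) = Im w / pi" for w
    by (simp add: Re_divide_of_real)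
  have Im_r: "Im (w / complex_of_real N * complex_of_real r) = Im w / N * r" for w
    by (simp add: Im_divide_of_real)
  have "Im ((1 + complex_of_real t * z) * cnj (complex_of_real t - z)) = y * (1 + t\<^sup>2)"
    by (simp add: z_def algebra_simps power2_eq_square)
  then have "Im ((1 + complex_of_real t * z) * cnj (complex_of_real t - z) / complex_of_real N * complex_of_real r) / pi = poisson y (x - t)"
    unfolding Im_r using t N by (simp add: poisson_def N_def r_def divide_inverse)
  then show ?thesis
    unfolding z_def[symmetric] r_def[symmetric] e Re_i .
qed

lemma Re_herglotz:
  assumes U[measurable]: "U \<in> sets borel" and y: "y > 0"
  shows "integrable lborel (\<lambda>t. indicat_real U t * poisson y (x - t))"
    and "Re (herglotz U (Complex x y)) = (LINT t|lborel. indicat_real U t * poisson y (x - t))"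
proof -
  let ?u = "\<lambda>t. complex_of_real (indicat_real U t * inverse (1 + t\<^sup>2))"
  let ?z = "Complex x y"
  have u: "integrable lborel ?u"
    by (intro integrable_of_real integrable_indicator_one_plus_square U)
  have iq: "integrable lborel (\<lambda>t. ?u t / (complex_of_real t - ?z))"
    by (rule integrable_divide_bounded_below[OF u, of _ y]) (use y dist_real_ge_Im[of ?z] in auto)
  define H where "H t = - \<i> / pi * ((1 + ?z\<^sup>2) * (?u t / (complex_of_real t - ?z)) + ?z * ?u t)" for t
  have iH: "integrable lborel H"
    unfolding H_def by (intro integrable_mult_right Bochner_Integration.integrable_add iq u)
  have ReH: "Re (H t) = indicat_real U t * poisson y (x - t)" for t
  proof (cases "t \<in> U")
    case True
    then show ?thesis unfolding H_def using Re_herglotz_kernel[OF y, of x t]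
      by (simp only: indicator_simps mult_1_left)
  qed (simp add: H_def)
  have "herglotz U ?z = (LINT t|lborel. H t)"
    unfolding H_def herglotz_def cauchy_transform_def
    using iq u by (simp only: integral_mult_right_zero Bochner_Integration.integral_add integrable_mult_right integral_complex_of_real)
  then show "Re (herglotz U ?z) = (LINT t|lborel. indicat_real U t * poisson y (x - t))"
    unfolding ReH[symmetric] using iH by simp
  show "integrable lborel (\<lambda>t. indicat_real U t * poisson y (x - t))"
    using integrable_Re[OF iH] by (simp add: ReH)
qed

lemma Re_herglotz_nonneg:
  assumes "U \<in> sets borel" "Im z > 0"
  shows "Re (herglotz U z) \<ge> 0"
  using Re_herglotz(2)[OF assms, of "Re z"] assms(2)
  by (auto intro!: integral_nonneg_AE simp: poisson_nonneg)

text \<open>A point at height \<open>y\<close> sees an interval of radius \<open>2y\<close> below it under a harmonic measure bounded from below;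
  the crude bound \<open>4y \<cdot> y / (\<pi> \<cdot> 5y\<^sup>2)\<close> for it suffices.\<close>

lemma Re_herglotz_tent:
  assumes U: "U \<in> sets borel" and y: "y > 0" and tent: "{x - 2 * y<..<x + 2 * y} \<subseteq> U"
  shows "Re (herglotz U (Complex x y)) \<ge> 1 / 4"
proof -
  have pi: "pi \<le> 3.2" using pi_approx by simp
  have "(1/4::real) \<le> 4 * y * (1 / (5 * pi * y))" using y pi by (simp add: field_simps)
  also have "\<dots> = (LINT t|lborel. indicat_real {x - 2 * y<..<x + 2 * y} t * (1 / (5 * pi * y)))"
    using y by simp
  also have "\<dots> \<le> (LINT t|lborel. indicat_real U t * poisson y (x - t))"
  proof (rule integral_mono)
    show "integrable lborel (\<lambda>t. indicat_real {x - 2 * y<..<x + 2 * y} t * (1 / (5 * pi * y)))"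
      using y by (intro integrable_mult_left integrable_real_indicator) auto
    show "integrable lborel (\<lambda>t. indicat_real U t * poisson y (x - t))" by (rule Re_herglotz(1)[OF U y])
    fix t
    show "indicat_real {x - 2 * y<..<x + 2 * y} t * (1 / (5 * pi * y)) \<le> indicat_real U t * poisson y (x - t)"
    proof (cases "t \<in> {x - 2 * y<..<x + 2 * y}")
      case True
      then have "\<bar>x - t\<bar> \<le> 2 * y" by auto
      then have "(x - t)\<^sup>2 \<le> (2 * y)\<^sup>2" by (rule power2_le_iff_abs_le[THEN iffD2, rotated]) (use y in auto)
      then have s: "(x - t)\<^sup>2 + y\<^sup>2 \<le> 5 * y\<^sup>2" by (simp add: power_mult_distrib)
      have "1 / (5 * pi * y) = y / (pi * (5 * y\<^sup>2))" using y by (simp add: field_simps power2_eq_square)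
      also have "\<dots> \<le> y / (pi * ((x - t)\<^sup>2 + y\<^sup>2))"
        using s y by (intro divide_left_mono mult_left_mono mult_pos_pos add_nonneg_pos) auto
      finally show ?thesis using True tent by (auto simp: poisson_def indicator_def)
    next
      case False
      then show ?thesis using poisson_nonneg[of y "x - t"] y by simp
    qed
  qed
  finally show ?thesis using Re_herglotz(2)[OF U y, of x] by simp
qed

text \<open>With \<open>Re (herglotz U) \<ge> 0\<close>, the function \<open>1 / (1 + l h)\<close> is bounded by \<open>1\<close>, and for large \<open>l\<close> it is small wherever
  the real part of \<open>h\<close> is not, in particular above \<open>U\<close>. If the weighted measure of \<open>U\<close>, which is \<open>\<pi> h(i)\<close>, is small
  compared with \<open>1 / l\<close>, it is close to \<open>1\<close> on most of each horizontal line.\<close>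

definition suppressor :: "real set \<Rightarrow> real \<Rightarrow> complex \<Rightarrow> complex" where
  "suppressor U l z = 1 / (1 + complex_of_real l * herglotz U z)"

lemma suppressor_denominator:
  assumes "U \<in> sets borel" "l \<ge> 0" "Im z > 0"
  shows "cmod (1 + complex_of_real l * herglotz U z) \<ge> 1 + l * Re (herglotz U z)"
  using complex_Re_le_cmod[of "1 + complex_of_real l * herglotz U z"] by simp

lemma
  assumes U: "U \<in> sets borel" and l: "l \<ge> 0"
  shows suppressor_holomorphic: "suppressor U l holomorphic_on upper_half_plane"
    and suppressor_le_1: "\<And>z. Im z > 0 \<Longrightarrow> cmod (suppressor U l z) \<le> 1"
    and suppressor_tent: "\<And>x y. y > 0 \<Longrightarrow> {x - 2 * y<..<x + 2 * y} \<subseteq> U \<Longrightarrow>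
        cmod (suppressor U l (Complex x y)) \<le> 1 / (1 + l / 4)"
    and suppressor_near_1: "\<And>z. Im z > 0 \<Longrightarrow> cmod (1 - suppressor U l z) \<le> l * cmod (herglotz U z)"
proof -
  have ge1: "cmod (1 + complex_of_real l * herglotz U z) \<ge> 1" if "Im z > 0" for z
    using suppressor_denominator[OF U l that] mult_nonneg_nonneg[OF l Re_herglotz_nonneg[OF U that]] by linarith
  have nz: "1 + complex_of_real l * herglotz U z \<noteq> 0" if "Im z > 0" for z using ge1[OF that] by auto
  show "suppressor U l holomorphic_on upper_half_plane"
    unfolding suppressor_def[abs_def] using nz
    by (intro holomorphic_intros herglotz_holomorphic U) (auto simp: upper_half_plane_def)
  show le1: "cmod (suppressor U l z) \<le> 1" if "Im z > 0" for z
    using ge1[OF that] by (simp add: suppressor_def norm_divide divide_le_eq)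
  show "cmod (suppressor U l (Complex x y)) \<le> 1 / (1 + l / 4)"
    if "y > 0" "{x - 2 * y<..<x + 2 * y} \<subseteq> U" for x y
  proof -
    have "1 + l / 4 \<le> 1 + l * Re (herglotz U (Complex x y))"
      using mult_left_mono[OF Re_herglotz_tent[OF U that] l] by simp
    also have "\<dots> \<le> cmod (1 + complex_of_real l * herglotz U (Complex x y))"
      using suppressor_denominator[OF U l, of "Complex x y"] that by simp
    finally show ?thesis unfolding suppressor_def norm_divide norm_one
      using l by (intro divide_left_mono mult_pos_pos) auto
  qed
  show "cmod (1 - suppressor U l z) \<le> l * cmod (herglotz U z)" if "Im z > 0" for z
  proof -
    have "1 - suppressor U l z = complex_of_real l * herglotz U z * suppressor U l z"
      using nz[OF that] by (simp add: suppressor_def field_simps)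
    then have "cmod (1 - suppressor U l z) = l * cmod (herglotz U z) * cmod (suppressor U l z)"
      using l by (simp add: norm_mult)
    also have "\<dots> \<le> l * cmod (herglotz U z) * 1" using le1[OF that] l by (intro mult_left_mono) auto
    finally show ?thesis by simp
  qed
qed

text \<open>Kolmogorov's trick: as \<open>\<bar>k\<bar> \<le> 1\<close>, one has \<open>\<bar>1 - k\<bar>\<^sup>2 \<le> 2 Re (1 - k)\<close>, and the Poisson mean of the right-hand side is
  the value of a harmonic function at a single point, which tends to \<open>0\<close> with the weighted measure of \<open>U\<close>.\<close>

lemma suppressor_L2:
  assumes U: "U \<in> sets borel" and l: "l \<ge> 0" and y: "y > 0"
  shows "integrable lborel (\<lambda>x. (cmod (1 - suppressor U l (Complex x y)))\<^sup>2 * inverse (1 + x\<^sup>2))"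
    and "(LINT x|lborel. (cmod (1 - suppressor U l (Complex x y)))\<^sup>2 * inverse (1 + x\<^sup>2))
       \<le> 2 * pi * l * cmod (herglotz U (\<i> * complex_of_real (1 + y)))"
proof -
  define K where "K = suppressor U l"
  have hol: "K holomorphic_on upper_half_plane" unfolding K_def by (rule suppressor_holomorphic[OF U l])
  have le1: "cmod (K z) \<le> 1" if "Im z > 0" for z unfolding K_def by (rule suppressor_le_1[OF U l that])
  have [measurable]: "(\<lambda>x. K (Complex x y)) \<in> borel_measurable borel"
    by (rule measurable_horizontal, rule continuous_on_subset[OF holomorphic_upper_continuous[OF hol y]]) auto
  have ip: "integrable lborel (\<lambda>x::real. inverse (1 + x\<^sup>2))" by (rule integrable_inverse_one_plus_square)
  have iK: "integrable lborel (\<lambda>x. K (Complex x y) * complex_of_real (inverse (1 + x\<^sup>2)))"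
  proof (rule Bochner_Integration.integrable_bound[OF ip])
    have "norm (K (Complex x y) * complex_of_real (inverse (1 + x\<^sup>2))) \<le> norm (inverse (1 + x\<^sup>2))" for x
      using le1[of "Complex x y"] y unfolding norm_mult norm_of_real real_norm_def
      by (intro mult_left_le_one_le) auto
    then show "AE x in lborel. norm (K (Complex x y) * complex_of_real (inverse (1 + x\<^sup>2))) \<le> norm (inverse (1 + x\<^sup>2))" by simp
  qed measurable
  have sq: "(cmod (1 - w))\<^sup>2 \<le> 2 * (1 - Re w)" if "cmod w \<le> 1" for w
  proof -
    have "(cmod w)\<^sup>2 \<le> 1" using that by (simp add: power_le_one)
    then show ?thesis unfolding cmod_power2 by (simp add: power2_eq_square algebra_simps)
  qed
  define D where "D x = 2 * inverse (1 + x\<^sup>2) - 2 * Re (K (Complex x y) * complex_of_real (inverse (1 + x\<^sup>2)))" for x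
  have iRe: "integrable lborel (\<lambda>x. Re (K (Complex x y) * complex_of_real (inverse (1 + x\<^sup>2))))" by (rule integrable_Re[OF iK])
  have iD: "integrable lborel D"
    unfolding D_def by (intro Bochner_Integration.integrable_diff integrable_mult_right ip iRe)
  have D: "(cmod (1 - K (Complex x y)))\<^sup>2 * inverse (1 + x\<^sup>2) \<le> D x" for x
  proof -
    have "(cmod (1 - K (Complex x y)))\<^sup>2 * inverse (1 + x\<^sup>2) \<le> 2 * (1 - Re (K (Complex x y))) * inverse (1 + x\<^sup>2)"
      using le1[of "Complex x y"] y by (intro mult_right_mono sq) auto
    also have "\<dots> = D x"
    proof -
      have "Re (w * complex_of_real r) = Re w * r" for w r by simp
      then show ?thesis unfolding D_def by (simp only: left_diff_distrib right_diff_distrib mult.assoc mult_1_left mult_1_right)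
    qed
    finally show ?thesis .
  qed
  show i: "integrable lborel (\<lambda>x. (cmod (1 - suppressor U l (Complex x y)))\<^sup>2 * inverse (1 + x\<^sup>2))"
    unfolding K_def[symmetric]
    by (rule Bochner_Integration.integrable_bound[OF iD]) (auto intro!: AE_I2 order_trans[OF D])
  have "(LINT x|lborel. (cmod (1 - K (Complex x y)))\<^sup>2 * inverse (1 + x\<^sup>2)) \<le> (LINT x|lborel. D x)"
    using i[folded K_def] iD D by (rule integral_mono)
  also have "(LINT x|lborel. D x) = 2 * pi - 2 * Re (LINT x|lborel. K (Complex x y) * complex_of_real (inverse (1 + x\<^sup>2)))"
    unfolding D_def integral_Re[OF iK, symmetric] using ip iRe
    by (simp only: Bochner_Integration.integral_diff integrable_mult_right integral_mult_right_zero integral_inverse_one_plus_square)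
  also have "\<dots> = 2 * pi * Re (1 - K (\<i> * complex_of_real (1 + y)))"
  proof -
    have "Re (LINT x|lborel. K (Complex x y) * complex_of_real (inverse (1 + x\<^sup>2))) = pi * Re (K (\<i> * complex_of_real (1 + y)))"
      by (subst poisson_formula_bounded[OF hol le1 y]) (assumption, simp)
    then show ?thesis by (simp add: right_diff_distrib)
  qed
  also have "\<dots> \<le> 2 * pi * cmod (1 - K (\<i> * complex_of_real (1 + y)))"
    by (intro mult_left_mono complex_Re_le_cmod) auto
  also have "\<dots> \<le> 2 * pi * (l * cmod (herglotz U (\<i> * complex_of_real (1 + y))))"
    unfolding K_def using y by (intro mult_left_mono suppressor_near_1[OF U l]) auto
  finally show "(LINT x|lborel. (cmod (1 - suppressor U l (Complex x y)))\<^sup>2 * inverse (1 + x\<^sup>2))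
       \<le> 2 * pi * l * cmod (herglotz U (\<i> * complex_of_real (1 + y)))" by (simp add: K_def mult.assoc)
qed

section \<open>Boundary functions have no negative frequencies\<close>

lemma integrable_mult_bounded:
  fixes u v :: "real \<Rightarrow> complex"
  assumes "integrable lborel u" and [measurable]: "v \<in> borel_measurable borel" and "\<And>x. cmod (v x) \<le> 1"
  shows "integrable lborel (\<lambda>x. u x * v x)"
proof (rule Bochner_Integration.integrable_bound[OF assms(1)])
  show "AE x in lborel. norm (u x * v x) \<le> norm (u x)"
    using assms(3) by (auto simp: norm_mult intro!: AE_I2 mult_left_le)
qed (use assms in auto)

text \<open>For \<open>e = 0\<close> this is the exponential against which a boundary function has to be integrated; the denominator
  supplies the decay that the contour argument needs and tends to \<open>1\<close> with \<open>e\<close>.\<close>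

definition test_kernel :: "real \<Rightarrow> real \<Rightarrow> complex \<Rightarrow> complex" where
  "test_kernel e t z = exp (\<i> * complex_of_real t * z) / (1 - \<i> * complex_of_real e * z)\<^sup>2"

lemma
  assumes e: "e > 0" and t: "t \<ge> 0"
  shows test_kernel_holomorphic: "test_kernel e t holomorphic_on upper_half_plane"
    and test_kernel_isCont: "\<And>z. Im z \<ge> 0 \<Longrightarrow> isCont (test_kernel e t) z"
    and test_kernel_decay: "\<And>z. Im z > 0 \<Longrightarrow> cmod (test_kernel e t z) \<le> 1 / (e\<^sup>2 * (cmod z)\<^sup>2)"
    and test_kernel_line: "\<And>z. Im z \<ge> 0 \<Longrightarrow> cmod (test_kernel e t z) \<le> (1 + 1 / e\<^sup>2) * inverse (1 + (Re z)\<^sup>2)"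
    and test_kernel_le_1: "\<And>z. Im z \<ge> 0 \<Longrightarrow> cmod (test_kernel e t z) \<le> 1"
proof -
  have sq: "(cmod (1 - \<i> * complex_of_real e * z))\<^sup>2 = (1 + e * Im z)\<^sup>2 + e\<^sup>2 * (Re z)\<^sup>2" for z
    unfolding cmod_power2 by (simp add: power_mult_distrib)
  have nz: "1 - \<i> * complex_of_real e * z \<noteq> 0" if "Im z \<ge> 0" for z
  proof
    assume "1 - \<i> * complex_of_real e * z = 0"
    from arg_cong[OF this, of Re] have "1 + e * Im z = 0" by simp
    then show False using mult_nonneg_nonneg[of e "Im z"] e that by linarith
  qed
  have ex: "cmod (exp (\<i> * complex_of_real t * z)) \<le> 1" if "Im z \<ge> 0" for z
    using that t by (simp add: mult_nonneg_nonneg)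
  have bd: "cmod (test_kernel e t z) \<le> 1 / a" if z: "Im z \<ge> 0" and a: "a > 0" "a \<le> (cmod (1 - \<i> * complex_of_real e * z))\<^sup>2" for z a
    unfolding test_kernel_def norm_divide norm_power
    using ex[OF z] a by (intro frac_le) auto
  show "test_kernel e t holomorphic_on upper_half_plane"
    unfolding test_kernel_def[abs_def] using nz
    by (intro holomorphic_intros) (auto simp: upper_half_plane_def less_imp_le)
  show "isCont (test_kernel e t) z" if "Im z \<ge> 0" for z
    unfolding test_kernel_def[abs_def] using nz[OF that] by (intro continuous_intros) auto
  have Im1: "(1 + e * Im z)\<^sup>2 \<ge> 1 + e\<^sup>2 * (Im z)\<^sup>2" if "Im z \<ge> 0" for z
  proof -
    have "(1 + e * Im z)\<^sup>2 = 1 + 2 * (e * Im z) + e\<^sup>2 * (Im z)\<^sup>2" by (simp add: power2_eq_square algebra_simps)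
    then show ?thesis using mult_nonneg_nonneg[of e "Im z"] e that by linarith
  qed
  show "cmod (test_kernel e t z) \<le> 1 / (e\<^sup>2 * (cmod z)\<^sup>2)" if z: "Im z > 0" for z
  proof -
    have "z \<noteq> 0" using z by auto
    have "e\<^sup>2 * (cmod z)\<^sup>2 = e\<^sup>2 * (Re z)\<^sup>2 + e\<^sup>2 * (Im z)\<^sup>2" unfolding cmod_power2 by (simp add: distrib_left)
    also have "\<dots> \<le> (cmod (1 - \<i> * complex_of_real e * z))\<^sup>2" unfolding sq using Im1[of z] z by linarith
    finally show ?thesis using e \<open>z \<noteq> 0\<close> z by (intro bd) auto
  qed
  have low: "1 + e\<^sup>2 * (Re z)\<^sup>2 \<le> (cmod (1 - \<i> * complex_of_real e * z))\<^sup>2" if "Im z \<ge> 0" for z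
  proof -
    have "0 \<le> e\<^sup>2 * (Im z)\<^sup>2" by simp
    then show ?thesis unfolding sq using Im1[OF that] by linarith
  qed
  show "cmod (test_kernel e t z) \<le> (1 + 1 / e\<^sup>2) * inverse (1 + (Re z)\<^sup>2)" if z: "Im z \<ge> 0" for z
  proof -
    have p: "1 + e\<^sup>2 * (Re z)\<^sup>2 > 0" by (intro add_pos_nonneg) auto
    have p': "1 + (Re z)\<^sup>2 > 0" by (intro add_pos_nonneg) auto
    have "1 + (Re z)\<^sup>2 \<le> (1 + 1 / e\<^sup>2) * (1 + e\<^sup>2 * (Re z)\<^sup>2)"
      using e by (simp add: field_simps)
    then have "1 / (1 + e\<^sup>2 * (Re z)\<^sup>2) \<le> (1 + 1 / e\<^sup>2) * inverse (1 + (Re z)\<^sup>2)"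
      using p p' by (simp add: divide_simps mult.commute)
    then show ?thesis using bd[OF z p low[OF z]] by linarith
  qed
  show "cmod (test_kernel e t z) \<le> 1" if z: "Im z \<ge> 0" for z
  proof -
    have "0 \<le> e\<^sup>2 * (Re z)\<^sup>2" by simp
    then have "1 \<le> (cmod (1 - \<i> * complex_of_real e * z))\<^sup>2" using low[OF z] by linarith
    from bd[OF z _ this] show ?thesis by simp
  qed
qed

text \<open>The points whose Stolz angle, truncated at height \<open>1 / (n + 1)\<close>, contains a value of \<open>F\<close> exceeding \<open>n\<close>.
  One value at height \<open>y\<close> puts a whole interval of radius \<open>2y\<close> into this set, so that
  \<open>F\<close> exceeds \<open>n\<close> close to the axis only where a suppressor of the set is small.\<close>

definition bad_set :: "(complex \<Rightarrow> complex) \<Rightarrow> nat \<Rightarrow> real set" where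
  "bad_set F n = {x. \<exists>z\<in>stolz_angle 2 x. Im z < 1 / Suc n \<and> cmod (F z) > n}"

lemma open_bad_set: "open (bad_set F n)"
proof -
  have "bad_set F n = (\<Union>z\<in>{z. 0 < Im z \<and> Im z < 1 / Suc n \<and> cmod (F z) > n}. {Re z - 2 * Im z<..<Re z + 2 * Im z})"
    unfolding bad_set_def stolz_angle_def by (auto simp: abs_less_iff)
  then show ?thesis by auto
qed

lemma bad_set_tent:
  assumes "0 < y" "y < 1 / Suc n" "cmod (F (Complex x y)) > n"
  shows "{x - 2 * y<..<x + 2 * y} \<subseteq> bad_set F n"
proof
  fix s assume "s \<in> {x - 2 * y<..<x + 2 * y}"
  then have "Complex x y \<in> stolz_angle 2 s" using assms(1) by (auto simp: stolz_angle_def abs_less_iff)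
  then show "s \<in> bad_set F n" unfolding bad_set_def using assms by force
qed

lemma eventually_not_in_bad_set:
  assumes "has_angular_limit F x l"
  shows "eventually (\<lambda>n. x \<notin> bad_set F n) sequentially"
proof -
  have "(F \<longlongrightarrow> l) (at (complex_of_real x) within stolz_angle 2 x)"
    using assms by (simp add: has_angular_limit_def)
  then have "eventually (\<lambda>z. dist (F z) l < 1) (at (complex_of_real x) within stolz_angle 2 x)"
    by (rule tendstoD) simp
  then obtain d where d: "d > 0" "\<And>z. z \<in> stolz_angle 2 x \<Longrightarrow> z \<noteq> complex_of_real x \<Longrightarrow> dist z (complex_of_real x) < d \<Longrightarrow> dist (F z) l < 1"
    unfolding eventually_at by blast
  obtain N where N: "real N \<ge> cmod l + 1 + 3 / d" using real_arch_simple by blast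
  have "x \<notin> bad_set F n" if n: "n \<ge> N" for n
  proof
    assume "x \<in> bad_set F n"
    then obtain z where z: "z \<in> stolz_angle 2 x" "Im z < 1 / Suc n" "cmod (F z) > n"
      unfolding bad_set_def by blast
    have nd: "real n \<ge> cmod l + 1" "real n \<ge> 3 / d"
    proof -
      have "3 / d > 0" using d by simp
      then show "real n \<ge> cmod l + 1" using N n by linarith
      show "real n \<ge> 3 / d" using N n norm_ge_zero[of l] by linarith
    qed
    have "z \<noteq> complex_of_real x" using z(1) by (auto simp: stolz_angle_def)
    moreover have "dist z (complex_of_real x) < d"
    proof -
      have "cmod (z - complex_of_real x) \<le> \<bar>Re z - x\<bar> + \<bar>Im z\<bar>"
        using cmod_le[of "z - complex_of_real x"] by simp
      also have "\<dots> < 3 * Im z" using z(1) by (simp add: stolz_angle_def)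
      also have "\<dots> < 3 * (1 / Suc n)" using z(2) by simp
      also have "\<dots> \<le> d" using nd(2) d(1) by (simp add: field_simps)
      finally show ?thesis by (simp add: dist_norm)
    qed
    ultimately have "dist (F z) l < 1" using d(2) z(1) by blast
    then have "cmod (F z) < cmod l + 1" using norm_triangle_ineq2[of "F z" l] by (simp add: dist_norm)
    then show False using z(3) nd(1) by linarith
  qed
  then show ?thesis unfolding eventually_sequentially by blast
qed

lemma has_angular_limit_vertical:
  assumes "has_angular_limit F x l" "\<And>n. y n > 0" "y \<longlonglongrightarrow> 0"
  shows "(\<lambda>n. F (Complex x (y n))) \<longlonglongrightarrow> l"
proof -
  have "(F \<longlongrightarrow> l) (at (complex_of_real x) within stolz_angle 2 x)"
    using assms(1) by (simp add: has_angular_limit_def)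
  moreover have "filterlim (\<lambda>n. Complex x (y n)) (at (complex_of_real x) within stolz_angle 2 x) sequentially"
    unfolding filterlim_at
  proof
    show "\<forall>\<^sub>F n in sequentially. Complex x (y n) \<in> stolz_angle 2 x \<and> Complex x (y n) \<noteq> complex_of_real x"
      using assms(2) by (intro always_eventually) (auto simp: stolz_angle_def complex_eq_iff less_imp_neq[symmetric])
    have "(\<lambda>n. Complex x (y n)) \<longlonglongrightarrow> Complex x 0" by (intro tendsto_Complex tendsto_const assms)
    then show "(\<lambda>n. Complex x (y n)) \<longlonglongrightarrow> complex_of_real x" by (simp add: complex_of_real_def)
  qed
  ultimately show ?thesis by (rule filterlim_compose)
qed

lemma bad_set_measure_tendsto_0:
  assumes "AE x in lborel. has_angular_limit F x (f x)"
  shows "(\<lambda>n. LINT t|lborel. indicat_real (bad_set F n) t * inverse (1 + t\<^sup>2)) \<longlonglongrightarrow> 0"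
proof -
  have [measurable]: "bad_set F n \<in> sets borel" for n using open_bad_set by auto
  have "(\<lambda>n. LINT t|lborel. indicat_real (bad_set F n) t * inverse (1 + t\<^sup>2)) \<longlonglongrightarrow> (LINT t::real|lborel. 0)"
  proof (rule integral_dominated_convergence[where w="\<lambda>t. inverse (1 + t\<^sup>2)"])
    show "AE t in lborel. (\<lambda>n. indicat_real (bad_set F n) t * inverse (1 + t\<^sup>2)) \<longlonglongrightarrow> 0"
      using assms
    proof (rule AE_mp, intro AE_I2 impI)
      fix t assume "has_angular_limit F t (f t)"
      from eventually_not_in_bad_set[OF this]
      show "(\<lambda>n. indicat_real (bad_set F n) t * inverse (1 + t\<^sup>2)) \<longlonglongrightarrow> 0"
        by (intro tendsto_eventually) (auto elim!: eventually_mono)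
    qed
  qed (use integrable_inverse_one_plus_square in \<open>auto simp: indicator_def\<close>)
  then show ?thesis by simp
qed

text \<open>Pointwise form of the decisive estimate. Here \<open>f\<close> and \<open>b0\<close> stand for boundary values, \<open>F\<close> and \<open>b\<close> for values at
  height \<open>y\<close>, and \<open>k\<close> for a suppressor. The five error terms come from moving \<open>b\<close> to the boundary, from
  the large values of \<open>f\<close>, from \<open>k \<noteq> 1\<close> (where \<open>\<bar>1 - k\<bar> \<le> \<kappa> + \<bar>1 - k\<bar>\<^sup>2 / \<kappa>\<close> brings in the mean square), from \<open>F \<noteq> f\<close> where
  \<open>F\<close> is bounded, and from the places where \<open>F\<close> is large but suppressed.\<close>

lemma split_error:
  fixes f F k b b0 :: complex
  assumes M: "M > 0" and \<kappa>: "\<kappa> > 0" and l: "l \<ge> 0"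
    and k1: "cmod k \<le> 1" and b1: "cmod b \<le> 1" and b\<beta>: "cmod b \<le> \<beta>"
    and kF: "cmod F > n \<Longrightarrow> cmod k \<le> 1 / (1 + l / 4)"
  shows "cmod (f * b0 - F * k * b) \<le> cmod f * cmod (b0 - b)
      + (2 * (cmod f * of_bool (cmod f > M)) + M * (\<kappa> * \<beta> + (cmod (1 - k))\<^sup>2 * \<beta> / \<kappa>))
      + (of_bool (cmod F \<le> n) * cmod (F - f) * \<beta> + (cmod F + cmod f) / (1 + l / 4))"
proof -
  have \<beta>: "\<beta> \<ge> 0" using b\<beta> norm_ge_zero order_trans by blast
  have e: "f * b0 - F * k * b = f * (b0 - b) + f * b * (1 - k) - (F - f) * k * b"
    by (simp add: algebra_simps)
  have "cmod (f * b0 - F * k * b) \<le> cmod (f * (b0 - b)) + cmod (f * b * (1 - k)) + cmod ((F - f) * k * b)"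
    unfolding e using norm_triangle_ineq4[of "f * (b0 - b) + f * b * (1 - k)" "(F - f) * k * b"]
      norm_triangle_ineq[of "f * (b0 - b)" "f * b * (1 - k)"] by linarith
  moreover have "cmod (f * b * (1 - k)) \<le> 2 * (cmod f * of_bool (cmod f > M)) + M * (\<kappa> * \<beta> + (cmod (1 - k))\<^sup>2 * \<beta> / \<kappa>)"
  proof (cases "cmod f > M")
    case True
    have "cmod (1 - k) \<le> 2" using norm_triangle_ineq4[of 1 k] k1 by simp
    then have "cmod b * cmod (1 - k) \<le> 1 * 2" using b1 by (intro mult_mono) auto
    then have "cmod f * (cmod b * cmod (1 - k)) \<le> cmod f * 2" by (intro mult_left_mono) auto
    moreover have "0 \<le> M * (\<kappa> * \<beta> + (cmod (1 - k))\<^sup>2 * \<beta> / \<kappa>)" using M \<kappa> \<beta> by (intro mult_nonneg_nonneg add_nonneg_nonneg divide_nonneg_pos) auto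
    ultimately show ?thesis using True by (simp add: norm_mult mult.assoc)
  next
    case False
    have "cmod (1 - k) \<le> \<kappa> + (cmod (1 - k))\<^sup>2 / \<kappa>"
    proof (cases "cmod (1 - k) \<le> \<kappa>")
      case True
      have "0 \<le> (cmod (1 - k))\<^sup>2 / \<kappa>" using \<kappa> by simp
      then show ?thesis using True by linarith
    next
      case False
      then have "cmod (1 - k) * \<kappa> \<le> (cmod (1 - k))\<^sup>2" by (simp add: power2_eq_square mult_left_mono)
      then have "cmod (1 - k) \<le> (cmod (1 - k))\<^sup>2 / \<kappa>" using \<kappa> by (simp add: le_divide_eq)
      then show ?thesis using \<kappa> by linarith
    qed
    then have "cmod f * (cmod b * cmod (1 - k)) \<le> M * (\<beta> * (\<kappa> + (cmod (1 - k))\<^sup>2 / \<kappa>))"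
      using False b\<beta> M \<beta> by (intro mult_mono) auto
    also have "M * (\<beta> * (\<kappa> + (cmod (1 - k))\<^sup>2 / \<kappa>)) = M * (\<kappa> * \<beta> + (cmod (1 - k))\<^sup>2 * \<beta> / \<kappa>)"
      by (simp add: distrib_left mult.commute)
    finally show ?thesis using False by (simp add: norm_mult mult.assoc)
  qed
  moreover have "cmod ((F - f) * k * b) \<le> of_bool (cmod F \<le> n) * cmod (F - f) * \<beta> + (cmod F + cmod f) / (1 + l / 4)"
  proof (cases "cmod F \<le> n")
    case True
    have "cmod (F - f) * (cmod k * cmod b) \<le> cmod (F - f) * (1 * \<beta>)"
      using k1 b\<beta> \<beta> by (intro mult_left_mono mult_mono) auto
    moreover have "0 \<le> (cmod F + cmod f) / (1 + l / 4)" using l by simp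
    ultimately show ?thesis using True by (simp add: norm_mult mult.assoc)
  next
    case False
    have "cmod (F - f) * (cmod k * cmod b) \<le> (cmod F + cmod f) * (1 / (1 + l / 4) * 1)"
      using kF False b1 l by (intro mult_mono norm_triangle_ineq4) auto
    then show ?thesis using False by (simp add: norm_mult mult.assoc)
  qed
  moreover have "cmod (f * (b0 - b)) = cmod f * cmod (b0 - b)" by (rule norm_mult)
  ultimately show ?thesis by linarith
qed

text \<open>On each line the integral of \<open>F k b\<close> vanishes, so \<open>\<integral> f b\<close> is bounded by the integral of the error terms of the previous
  lemma. The limits have to be taken in this order: the height \<open>y\<close> tends to \<open>0\<close> for a fixed bad set, then the
  bad set shrinks for fixed \<open>M\<close>, \<open>\<kappa>\<close>, \<open>l\<close>, and finally these parameters go to their limits.\<close>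

lemma hardy_boundary_annihilates_test_kernel:
  assumes F: "F \<in> hardy_space" and f: "integrable lborel f"
    and lim: "AE x in lborel. has_angular_limit F x (f x)"
    and e: "e > 0" and t: "t \<ge> 0"
  shows "(LINT x|lborel. f x * test_kernel e t (complex_of_real x)) = 0"
proof -
  obtain C where hol: "F holomorphic_on upper_half_plane"
    and C: "\<And>y. y > 0 \<Longrightarrow> integrable lborel (\<lambda>x. F (Complex x y)) \<and> L1_norm (\<lambda>x. F (Complex x y)) \<le> C"
    using F unfolding hardy_space_def by blast
  have iF: "integrable lborel (\<lambda>x. F (Complex x y))" if "y > 0" for y using C[OF that] by blast
  have CF: "(LINT x|lborel. cmod (F (Complex x y))) \<le> C" if "y > 0" for y
    using C[OF that] by (simp add: L1_norm_def)
  have C0: "C \<ge> 0" by (rule order_trans[OF _ CF[of 1]]) auto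
  define b where "b = test_kernel e t"
  define B where "B = 1 + 1 / e\<^sup>2"
  have B: "B > 0" unfolding B_def using e by (intro add_pos_nonneg) auto
  define \<beta> where "\<beta> x = B * inverse (1 + x\<^sup>2)" for x :: real
  have bhol: "b holomorphic_on upper_half_plane" unfolding b_def by (rule test_kernel_holomorphic[OF e t])
  have b1: "cmod (b z) \<le> 1" if "Im z \<ge> 0" for z unfolding b_def by (rule test_kernel_le_1[OF e t that])
  have b\<beta>: "cmod (b z) \<le> \<beta> (Re z)" if "Im z \<ge> 0" for z
    unfolding b_def \<beta>_def B_def by (rule test_kernel_line[OF e t that])
  have bcont: "isCont b z" if "Im z \<ge> 0" for z unfolding b_def by (rule test_kernel_isCont[OF e t that])
  define b0 where "b0 x = b (complex_of_real x)" for x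
  have [measurable]: "f \<in> borel_measurable borel" using f by auto
  have [measurable]: "b0 \<in> borel_measurable borel"
  proof (intro borel_measurable_continuous_onI continuous_at_imp_continuous_on ballI)
    fix x :: real
    have "isCont (\<lambda>x. b (complex_of_real x)) x"
      by (rule isCont_o2[OF _ bcont]) (auto intro!: continuous_intros)
    then show "isCont b0 x" by (simp add: b0_def[abs_def])
  qed
  have [measurable]: "\<beta> \<in> borel_measurable borel" unfolding \<beta>_def by measurable
  have i\<beta>: "integrable lborel \<beta>"
    unfolding \<beta>_def by (intro integrable_mult_right integrable_inverse_one_plus_square)
  have \<beta>int: "(LINT x|lborel. \<beta> x) = B * pi"
    unfolding \<beta>_def using integral_inverse_one_plus_square by simp
  have \<beta>0: "\<beta> x \<ge> 0" for x using B by (simp add: \<beta>_def)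
  have ib0: "integrable lborel (\<lambda>x. f x * b0 x)"
    by (rule integrable_mult_bounded[OF f]) (measurable, simp add: b0_def b1)
  define U where "U = bad_set F"
  have U[measurable]: "U n \<in> sets borel" for n unfolding U_def using open_bad_set by auto
  define \<mu> where "\<mu> n = (LINT t|lborel. indicat_real (U n) t * inverse (1 + t\<^sup>2))" for n
  define y where "y j = 1 / real (Suc j)" for j :: nat
  have y: "y j > 0" "y \<longlonglongrightarrow> 0" for j
    unfolding y_def using LIMSEQ_Suc[OF lim_1_over_n] by auto
  define I where "I = (LINT x|lborel. f x * b0 x)"
  define tail where "tail M = (LINT x|lborel. cmod (f x) * of_bool (cmod (f x) > M))" for M
  \<comment> \<open>Cauchy's theorem on horizontal lines; \<open>F\<close> is bounded above each line.\<close>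
  have zero: "(LINT x|lborel. F (Complex x s) * suppressor (U n) l (Complex x s) * b (Complex x s)) = 0"
    if s: "s > 0" and l: "l \<ge> 0" for s l n
  proof -
    define A where "A = 1 + 2 * C / s"
    have A: "A \<ge> 0" using C0 s by (simp add: A_def)
    have FA: "cmod (F z) \<le> A" if "Im z \<ge> s" for z
    proof -
      have "cmod (F z) \<le> 1 + 2 * C / Im z"
        by (rule hardy_space_bound[OF hol]) (use C s that in auto)
      also have "2 * C / Im z \<le> 2 * C / s" using that s C0 by (intro divide_left_mono mult_pos_pos) auto
      finally show ?thesis by (simp add: A_def)
    qed
    have Gb: "cmod (F z * suppressor (U n) l z * b z) \<le> A * r" if "Im z \<ge> s" "cmod (b z) \<le> r" for z r
    proof -
      have "cmod (F z) * cmod (suppressor (U n) l z) * cmod (b z) \<le> A * 1 * r"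
        using FA[OF that(1)] that suppressor_le_1[OF U l, of z] s A by (intro mult_mono) auto
      then show ?thesis by (simp add: norm_mult)
    qed
    show ?thesis
    proof (rule line_integral_eq_0[where G="\<lambda>z. F z * suppressor (U n) l z * b z"])
      show "(\<lambda>z. F z * suppressor (U n) l z * b z) holomorphic_on upper_half_plane"
        by (intro holomorphic_on_mult hol bhol suppressor_holomorphic U l)
      show "cmod (F (Complex x s) * suppressor (U n) l (Complex x s) * b (Complex x s)) \<le> (A * B) * inverse (1 + x\<^sup>2)" for x
        using Gb[of "Complex x s", OF _ b\<beta>] s by (simp add: \<beta>_def mult.assoc)
      show "cmod (F z * suppressor (U n) l z * b z) \<le> (A / e\<^sup>2) / (cmod z)\<^sup>2" if "Im z \<ge> s" for z
        using Gb[OF that test_kernel_decay[OF e t, folded b_def]] that s by simp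
    qed (rule s)
  qed
  \<comment> \<open>The limit \<open>y \<longrightarrow> 0\<close>, for a fixed bad set.\<close>
  have est: "cmod I \<le> (2 * tail M + M * (\<kappa> * (B * pi) + B / \<kappa> * (2 * pi * l * (\<mu> n / pi)))) + (C + L1_norm f) / (1 + l / 4)"
    if M: "M > 0" and \<kappa>: "\<kappa> > 0" and l: "l \<ge> 0" for M \<kappa> l n
  proof -
    let ?k = "\<lambda>j x. suppressor (U n) l (Complex x (y j))"
    let ?F = "\<lambda>j x. F (Complex x (y j))"
    let ?b = "\<lambda>j x. b (Complex x (y j))"
    define T1 where "T1 j x = cmod (f x) * cmod (b0 x - ?b j x)" for j x
    define T2 where "T2 j x = 2 * (cmod (f x) * of_bool (cmod (f x) > M)) + M * (\<kappa> * \<beta> x + (cmod (1 - ?k j x))\<^sup>2 * \<beta> x / \<kappa>)" for j x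
    define T3 where "T3 j x = of_bool (cmod (?F j x) \<le> n) * cmod (?F j x - f x) * \<beta> x" for j x
    define T4 where "T4 j x = (cmod (?F j x) + cmod (f x)) / (1 + l / 4)" for j x
    have [measurable]: "?k j \<in> borel_measurable borel" "?F j \<in> borel_measurable borel" "?b j \<in> borel_measurable borel" for j
      by (rule horizontal_measurable_holomorphic[OF suppressor_holomorphic[OF U l] y(1)]
          horizontal_measurable_holomorphic[OF hol y(1)] horizontal_measurable_holomorphic[OF bhol y(1)])+
    have [measurable]: "T1 j \<in> borel_measurable borel" "T3 j \<in> borel_measurable borel" for j
      unfolding T1_def T3_def by measurable
    have bb: "cmod (b0 x - ?b j x) \<le> 2" for x j
      using norm_triangle_ineq4[of "b0 x" "?b j x"] b1[of "complex_of_real x"] b1[of "Complex x (y j)"] y(1)[of j]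
      by (simp add: b0_def)
    have i1: "integrable lborel (T1 j)" for j
    proof (rule Bochner_Integration.integrable_bound[where f="\<lambda>x. cmod (f x) * 2"])
      show "AE x in lborel. norm (T1 j x) \<le> norm (cmod (f x) * 2)"
        using bb by (auto simp: T1_def abs_mult intro!: AE_I2 mult_left_mono)
    qed (use f in auto)
    have it: "integrable lborel (\<lambda>x. cmod (f x) * of_bool (cmod (f x) > M))"
      by (rule Bochner_Integration.integrable_bound[where f="\<lambda>x. cmod (f x)"]) (use f in auto)
    have s2: "(\<lambda>x. (cmod (1 - ?k j x))\<^sup>2 * \<beta> x / \<kappa>) = (\<lambda>x. B / \<kappa> * ((cmod (1 - ?k j x))\<^sup>2 * inverse (1 + x\<^sup>2)))" for j
      by (auto simp: \<beta>_def)
    have i2a: "integrable lborel (\<lambda>x. (cmod (1 - ?k j x))\<^sup>2 * \<beta> x / \<kappa>)" for j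
      unfolding s2 by (intro integrable_mult_right suppressor_L2(1) U l y)
    have i2: "integrable lborel (T2 j)" for j
      unfolding T2_def by (intro Bochner_Integration.integrable_add integrable_mult_right it i\<beta> i2a)
    have I2: "(LINT x|lborel. T2 j x) \<le> 2 * tail M + M * (\<kappa> * (B * pi) + B / \<kappa> * (2 * pi * l * cmod (herglotz (U n) (\<i> * complex_of_real (1 + y j)))))" for j
    proof -
      have "(LINT x|lborel. T2 j x) = 2 * tail M + M * (\<kappa> * (B * pi) + (LINT x|lborel. (cmod (1 - ?k j x))\<^sup>2 * \<beta> x / \<kappa>))"
        unfolding T2_def tail_def \<beta>int[symmetric] using it i\<beta> i2a[of j]
        by (simp only: Bochner_Integration.integral_add Bochner_Integration.integrable_add integrable_mult_right integral_mult_right_zero)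
      moreover have "(LINT x|lborel. (cmod (1 - ?k j x))\<^sup>2 * \<beta> x / \<kappa>) \<le> B / \<kappa> * (2 * pi * l * cmod (herglotz (U n) (\<i> * complex_of_real (1 + y j))))"
        unfolding s2 integral_mult_right_zero
        using B \<kappa> by (intro mult_left_mono suppressor_L2(2) U l y) auto
      ultimately show ?thesis using M by simp
    qed
    have b3: "norm (T3 j x) \<le> n * \<beta> x + cmod (f x) * B" for j x
    proof -
      have "\<beta> x \<le> B"
        unfolding \<beta>_def using B by (intro mult_left_le) (auto simp: inverse_le_1_iff)
      then have "cmod (f x) * \<beta> x \<le> cmod (f x) * B" by (intro mult_left_mono) auto
      moreover have "of_bool (cmod (?F j x) \<le> n) * cmod (?F j x - f x) * \<beta> x \<le> (n + cmod (f x)) * \<beta> x"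
        using norm_triangle_ineq4[of "?F j x" "f x"] \<beta>0[of x] by (intro mult_right_mono) auto
      moreover have "norm (T3 j x) = T3 j x" using \<beta>0[of x] by (simp add: T3_def)
      ultimately show ?thesis by (simp add: T3_def distrib_right)
    qed
    have i3d: "integrable lborel (\<lambda>x. n * \<beta> x + cmod (f x) * B)"
      using i\<beta> f by auto
    have i3: "integrable lborel (T3 j)" for j
      by (rule Bochner_Integration.integrable_bound[OF i3d])
        (use order_trans[OF b3 abs_ge_self] in \<open>auto intro!: AE_I2\<close>)
    have i4: "integrable lborel (T4 j)" for j
      unfolding T4_def using f iF[OF y(1)[of j]] by auto
    have I4: "(LINT x|lborel. T4 j x) \<le> (C + L1_norm f) / (1 + l / 4)" for j
    proof -
      have "(LINT x|lborel. T4 j x) = ((LINT x|lborel. cmod (?F j x)) + L1_norm f) / (1 + l / 4)"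
        unfolding T4_def L1_norm_def using f iF[OF y(1)[of j]] by simp
      also have "\<dots> \<le> (C + L1_norm f) / (1 + l / 4)"
        using CF[OF y(1)[of j]] l by (intro divide_right_mono add_mono) auto
      finally show ?thesis .
    qed
    have step: "cmod I \<le> (LINT x|lborel. T1 j x) + (2 * tail M + M * (\<kappa> * (B * pi) + B / \<kappa> * (2 * pi * l * cmod (herglotz (U n) (\<i> * complex_of_real (1 + y j))))))
        + ((LINT x|lborel. T3 j x) + (C + L1_norm f) / (1 + l / 4))" if j: "j > n" for j
    proof -
      have yn: "y j < 1 / Suc n" using j by (simp add: y_def frac_less2)
      have iFk: "integrable lborel (\<lambda>x. ?F j x * ?k j x * ?b j x)"
        by (intro integrable_mult_bounded iF y) (use y(1)[of j] in \<open>auto intro!: b1 suppressor_le_1 U l\<close>)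
      have "I = (LINT x|lborel. f x * b0 x - ?F j x * ?k j x * ?b j x)"
        unfolding I_def using ib0 iFk zero[OF y(1) l] by simp
      also have "cmod \<dots> \<le> (LINT x|lborel. cmod (f x * b0 x - ?F j x * ?k j x * ?b j x))"
        by (rule integral_norm_bound)
      also have "\<dots> \<le> (LINT x|lborel. T1 j x + T2 j x + (T3 j x + T4 j x))"
      proof (rule integral_mono)
        show "integrable lborel (\<lambda>x. cmod (f x * b0 x - ?F j x * ?k j x * ?b j x))" using ib0 iFk by auto
        show "integrable lborel (\<lambda>x. T1 j x + T2 j x + (T3 j x + T4 j x))"
          by (intro Bochner_Integration.integrable_add i1 i2 i3 i4)
        fix x
        have "cmod (?k j x) \<le> 1 / (1 + l / 4)" if "cmod (?F j x) > n"
          using bad_set_tent[of "y j" n F x, OF y(1) yn that] by (intro suppressor_tent[OF U l y(1)]) (simp add: U_def)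
        then show "cmod (f x * b0 x - ?F j x * ?k j x * ?b j x) \<le> T1 j x + T2 j x + (T3 j x + T4 j x)"
          unfolding T1_def T2_def T3_def T4_def
          using y(1)[of j] b\<beta>[of "Complex x (y j)"]
          by (intro split_error M \<kappa> l b1 suppressor_le_1[OF U l]) auto
      qed
      also have "\<dots> = (LINT x|lborel. T1 j x) + (LINT x|lborel. T2 j x) + ((LINT x|lborel. T3 j x) + (LINT x|lborel. T4 j x))"
        using i1[of j] i2[of j] i3[of j] i4[of j]
        by (simp only: Bochner_Integration.integral_add Bochner_Integration.integrable_add)
      finally show ?thesis using I2[of j] I4[of j] by linarith
    qed
    have L1: "(\<lambda>j. LINT x|lborel. T1 j x) \<longlonglongrightarrow> 0"
    proof -
      have "(\<lambda>j. LINT x|lborel. T1 j x) \<longlonglongrightarrow> (LINT x::real|lborel. 0)"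
      proof (rule integral_dominated_convergence[where w="\<lambda>x. cmod (f x) * 2"])
        have "(\<lambda>j. T1 j x) \<longlonglongrightarrow> 0" for x
        proof -
          have "(\<lambda>j. Complex x (y j)) \<longlonglongrightarrow> Complex x 0" by (intro tendsto_Complex tendsto_const y)
          from isCont_tendsto_compose[OF bcont this] have "(\<lambda>j. ?b j x) \<longlonglongrightarrow> b0 x"
            by (simp add: b0_def complex_of_real_def)
          then show ?thesis unfolding T1_def by (auto intro!: tendsto_eq_intros)
        qed
        then show "AE x in lborel. (\<lambda>j. T1 j x) \<longlonglongrightarrow> 0" by simp
        show "AE x in lborel. norm (T1 j x) \<le> cmod (f x) * 2" for j
          using bb by (auto simp: T1_def abs_mult intro!: AE_I2 mult_left_mono)
      qed (use f in auto)
      then show ?thesis by simp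
    qed
    have L3: "(\<lambda>j. LINT x|lborel. T3 j x) \<longlonglongrightarrow> 0"
    proof -
      have "(\<lambda>j. LINT x|lborel. T3 j x) \<longlonglongrightarrow> (LINT x::real|lborel. 0)"
      proof (rule integral_dominated_convergence[OF _ _ i3d])
        show "AE x in lborel. (\<lambda>j. T3 j x) \<longlonglongrightarrow> 0"
          using lim
        proof (rule AE_mp, intro AE_I2 impI)
          fix x assume "has_angular_limit F x (f x)"
          from has_angular_limit_vertical[OF this y] have "(\<lambda>j. ?F j x) \<longlonglongrightarrow> f x" .
          then have "(\<lambda>j. cmod (?F j x - f x) * \<beta> x) \<longlonglongrightarrow> 0" by (auto intro!: tendsto_eq_intros)
          then show "(\<lambda>j. T3 j x) \<longlonglongrightarrow> 0"
            by (rule Lim_null_comparison[rotated]) (use \<beta>0 in \<open>auto simp: T3_def\<close>)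
        qed
        show "AE x in lborel. norm (T3 j x) \<le> n * \<beta> x + cmod (f x) * B" for j using b3 by simp
      qed auto
      then show ?thesis by simp
    qed
    have Lh: "(\<lambda>j. cmod (herglotz (U n) (\<i> * complex_of_real (1 + y j)))) \<longlonglongrightarrow> \<mu> n / pi"
    proof -
      have "continuous_on upper_half_plane (herglotz (U n))"
        by (intro holomorphic_on_imp_continuous_on herglotz_holomorphic U)
      then have c: "isCont (herglotz (U n)) \<i>"
        by (rule continuous_on_interior) (simp add: interior_open open_upper_half_plane, simp add: upper_half_plane_def)
      have "(\<lambda>j. \<i> * complex_of_real (1 + y j)) \<longlonglongrightarrow> \<i> * complex_of_real (1 + 0)"
        by (intro tendsto_intros y)
      then have "(\<lambda>j. \<i> * complex_of_real (1 + y j)) \<longlonglongrightarrow> \<i>" by simp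
      from tendsto_norm[OF isCont_tendsto_compose[OF c this]]
      have "(\<lambda>j. cmod (herglotz (U n) (\<i> * complex_of_real (1 + y j)))) \<longlonglongrightarrow> cmod (herglotz (U n) \<i>)" .
      also have "herglotz (U n) \<i> = complex_of_real (\<mu> n / pi)" by (simp add: herglotz_i \<mu>_def)
      also have "cmod \<dots> = \<mu> n / pi"
        unfolding norm_of_real by (auto simp: \<mu>_def intro!: abs_of_nonneg divide_nonneg_pos integral_nonneg_AE)
      finally show ?thesis .
    qed
    have "(\<lambda>j. (LINT x|lborel. T1 j x) + (2 * tail M + M * (\<kappa> * (B * pi) + B / \<kappa> * (2 * pi * l * cmod (herglotz (U n) (\<i> * complex_of_real (1 + y j))))))
        + ((LINT x|lborel. T3 j x) + (C + L1_norm f) / (1 + l / 4)))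
      \<longlonglongrightarrow> 0 + (2 * tail M + M * (\<kappa> * (B * pi) + B / \<kappa> * (2 * pi * l * (\<mu> n / pi)))) + (0 + (C + L1_norm f) / (1 + l / 4))"
      by (intro tendsto_add L1 L3 tendsto_mult tendsto_const Lh)
    from LIMSEQ_le_const[OF this, of "cmod I"] step
    have "cmod I \<le> 0 + (2 * tail M + M * (\<kappa> * (B * pi) + B / \<kappa> * (2 * pi * l * (\<mu> n / pi)))) + (0 + (C + L1_norm f) / (1 + l / 4))"
      by (meson less_eq_Suc_le)
    then show ?thesis by simp
  qed
  \<comment> \<open>The bad set shrinks to a null set.\<close>
  have est2: "cmod I \<le> (2 * tail M + M * (\<kappa> * (B * pi))) + (C + L1_norm f) / (1 + l / 4)"
    if M: "M > 0" and \<kappa>: "\<kappa> > 0" and l: "l \<ge> 0" for M \<kappa> l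
  proof -
    have "\<mu> \<longlonglongrightarrow> 0" unfolding \<mu>_def U_def by (rule bad_set_measure_tendsto_0[OF lim])
    then have "(\<lambda>n. (2 * tail M + M * (\<kappa> * (B * pi) + B / \<kappa> * (2 * pi * l * (\<mu> n / pi)))) + (C + L1_norm f) / (1 + l / 4))
       \<longlonglongrightarrow> (2 * tail M + M * (\<kappa> * (B * pi) + B / \<kappa> * (2 * pi * l * (0 / pi)))) + (C + L1_norm f) / (1 + l / 4)"
      by (intro tendsto_add tendsto_mult tendsto_const tendsto_divide) auto
    from LIMSEQ_le_const[OF this, of "cmod I"] est[OF that] show ?thesis by simp
  qed
  \<comment> \<open>Finally \<open>M = l = j + 1\<close> and \<open>\<kappa> = 1 / (j + 1)\<^sup>2\<close>: the square makes \<open>M \<kappa>\<close> tend to \<open>0\<close>.\<close>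
  define m where "m j = real (Suc j)" for j
  have m: "m j > 0" for j by (simp add: m_def)
  have tail0: "(\<lambda>j. tail (m j)) \<longlonglongrightarrow> 0"
  proof -
    have "(\<lambda>j. tail (m j)) \<longlonglongrightarrow> (LINT x::real|lborel. 0)"
      unfolding tail_def
    proof (rule integral_dominated_convergence[where w="\<lambda>x. cmod (f x)"])
      have "(\<lambda>j. cmod (f x) * of_bool (cmod (f x) > m j)) \<longlonglongrightarrow> 0" for x
      proof (rule tendsto_eventually)
        obtain N where "real N \<ge> cmod (f x)" using real_arch_simple by blast
        then have "cmod (f x) * of_bool (cmod (f x) > m j) = 0" if "j \<ge> N" for j using that by (simp add: m_def)
        then show "\<forall>\<^sub>F j in sequentially. cmod (f x) * of_bool (cmod (f x) > m j) = 0"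
          unfolding eventually_sequentially by blast
      qed
      then show "AE x in lborel. (\<lambda>j. cmod (f x) * of_bool (cmod (f x) > m j)) \<longlonglongrightarrow> 0" by simp
    qed (use f in auto)
    then show ?thesis by simp
  qed
  have "(\<lambda>j. (2 * tail (m j) + y j * (B * pi)) + (C + L1_norm f) * (4 * y j)) \<longlonglongrightarrow> (2 * 0 + 0 * (B * pi)) + (C + L1_norm f) * (4 * 0)"
    by (intro tendsto_add tendsto_mult tendsto_const tail0 y)
  moreover have "cmod I \<le> (2 * tail (m j) + y j * (B * pi)) + (C + L1_norm f) * (4 * y j)" for j
  proof -
    have "m j * (y j)\<^sup>2 = y j" using m[of j] by (simp add: y_def m_def power2_eq_square)
    moreover have "(C + L1_norm f) / (1 + m j / 4) \<le> (C + L1_norm f) * (4 * y j)"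
    proof -
      have "1 / (1 + m j / 4) \<le> 1 / (m j / 4)" using m[of j] by (intro divide_left_mono) auto
      also have "1 / (m j / 4) = 4 * y j" by (simp add: y_def m_def)
      finally have "1 / (1 + m j / 4) \<le> 4 * y j" .
      then have "(C + L1_norm f) * (1 / (1 + m j / 4)) \<le> (C + L1_norm f) * (4 * y j)"
        using C0 by (intro mult_left_mono) (auto simp: L1_norm_def)
      then show ?thesis by simp
    qed
    moreover have "cmod I \<le> (2 * tail (m j) + m j * ((y j)\<^sup>2 * (B * pi))) + (C + L1_norm f) / (1 + m j / 4)"
      using m[of j] y(1)[of j] by (intro est2) auto
    ultimately show ?thesis by (simp add: mult.assoc[symmetric])
  qed
  ultimately have "cmod I \<le> 0" using LIMSEQ_le_const by fastforce
  then show ?thesis by (simp add: I_def b0_def b_def)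
qed

text \<open>As \<open>e\<close> tends to \<open>0\<close>, the test kernels converge boundedly to the exponential on the real axis.\<close>

lemma fourier_H1_eq_0:
  assumes p: "p \<in> H1" and "\<xi> < 0"
  shows "fourier p \<xi> = 0"
proof -
  obtain F where F: "F \<in> hardy_space" "AE x in lborel. has_angular_limit F x (p x)" and i: "integrable lborel p"
    using p by (auto simp: H1_def)
  have [measurable]: "p \<in> borel_measurable borel" using i by auto
  define e where "e j = 1 / real (Suc j)" for j :: nat
  have e: "e j > 0" "e \<longlonglongrightarrow> 0" for j
    unfolding e_def using LIMSEQ_Suc[OF lim_1_over_n] by auto
  have t: "- \<xi> \<ge> 0" using assms by simp
  have "(\<lambda>j. LINT x|lborel. p x * test_kernel (e j) (- \<xi>) (complex_of_real x)) \<longlonglongrightarrow> fourier p \<xi>"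
    unfolding fourier_def
  proof (rule integral_dominated_convergence[where w="\<lambda>x. cmod (p x)"])
    have "(\<lambda>j. p x * test_kernel (e j) (- \<xi>) (complex_of_real x)) \<longlonglongrightarrow> p x * exp (- \<i> * complex_of_real (x * \<xi>))" for x
    proof -
      have "(\<lambda>j. test_kernel (e j) (- \<xi>) (complex_of_real x)) \<longlonglongrightarrow> exp (\<i> * complex_of_real (- \<xi>) * complex_of_real x) / (1 - \<i> * complex_of_real 0 * complex_of_real x)\<^sup>2"
        unfolding test_kernel_def by (intro tendsto_intros e) auto
      then show ?thesis by (intro tendsto_mult tendsto_const) (simp add: mult_ac)
    qed
    then show "AE x in lborel. (\<lambda>j. p x * test_kernel (e j) (- \<xi>) (complex_of_real x)) \<longlonglongrightarrow> p x * exp (- \<i> * complex_of_real (x * \<xi>))" by simp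
    show "AE x in lborel. norm (p x * test_kernel (e j) (- \<xi>) (complex_of_real x)) \<le> cmod (p x)" for j
      using test_kernel_le_1[OF e(1) t] by (auto simp: norm_mult intro!: AE_I2 mult_left_le)
  qed (use i in \<open>auto simp: test_kernel_def\<close>)
  then show ?thesis
    unfolding hardy_boundary_annihilates_test_kernel[OF F(1) i F(2) e(1) t] by (simp add: LIMSEQ_const_iff)
qed

section \<open>Best approximation\<close>

lemma norm_exp_ix [simp]: "cmod (exp (- \<i> * complex_of_real r)) = 1" "cmod (exp (- (\<i> * complex_of_real r))) = 1"
  using norm_exp_i_times[of "-r"] by simp_all

lemma L1_norm_triangle:
  assumes "integrable lborel u" "integrable lborel v"
  shows "L1_norm (\<lambda>x. u x + v x) \<le> L1_norm u + L1_norm v"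
proof -
  have "L1_norm (\<lambda>x. u x + v x) \<le> (LINT x|lborel. cmod (u x) + cmod (v x))"
    unfolding L1_norm_def using assms by (intro integral_mono norm_triangle_ineq) auto
  also have "\<dots> = L1_norm u + L1_norm v" using assms by (simp add: L1_norm_def)
  finally show ?thesis .
qed

lemma H1_add:
  assumes "u \<in> H1" "v \<in> H1"
  shows "(\<lambda>x. u x + v x) \<in> H1"
proof -
  obtain F G where F: "F \<in> hardy_space" "AE x in lborel. has_angular_limit F x (u x)"
    and G: "G \<in> hardy_space" "AE x in lborel. has_angular_limit G x (v x)"
    and i: "integrable lborel u" "integrable lborel v"
    using assms unfolding H1_def by auto
  obtain C where C: "\<And>y. y > 0 \<Longrightarrow> integrable lborel (\<lambda>x. F (Complex x y)) \<and> L1_norm (\<lambda>x. F (Complex x y)) \<le> C"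
    using F(1) unfolding hardy_space_def by blast
  obtain D where D: "\<And>y. y > 0 \<Longrightarrow> integrable lborel (\<lambda>x. G (Complex x y)) \<and> L1_norm (\<lambda>x. G (Complex x y)) \<le> D"
    using G(1) unfolding hardy_space_def by blast
  have "(\<lambda>z. F z + G z) \<in> hardy_space"
    unfolding hardy_space_def
  proof (intro CollectI conjI exI[of _ "C + D"] allI impI)
    show "(\<lambda>z. F z + G z) holomorphic_on upper_half_plane"
      using F(1) G(1) unfolding hardy_space_def by (auto intro: holomorphic_on_add)
    fix y :: real assume y: "y > 0"
    show "integrable lborel (\<lambda>x. F (Complex x y) + G (Complex x y))" using C[OF y] D[OF y] by auto
    show "L1_norm (\<lambda>x. F (Complex x y) + G (Complex x y)) \<le> C + D"
      using L1_norm_triangle[of "\<lambda>x. F (Complex x y)" "\<lambda>x. G (Complex x y)"] C[OF y] D[OF y] by linarith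
  qed
  moreover have "AE x in lborel. has_angular_limit (\<lambda>z. F z + G z) x (u x + v x)"
    using F(2) G(2) by (rule AE_mp[OF _ AE_mp]) (auto simp: has_angular_limit_def intro!: AE_I2 tendsto_add)
  ultimately show ?thesis using i unfolding H1_def by auto
qed

text \<open>Minimality extends from the Hardy space to its \<open>L\<^sup>1\<close>-closure, which contains the functions without
  negative frequencies as limits of their Poisson smoothings.\<close>

lemma best_H1_approx_minimal:
  assumes g: "integrable lborel g" and best: "best_H1_approx g p"
    and u: "integrable lborel u" and sp: "\<And>\<xi>. \<xi> < 0 \<Longrightarrow> fourier u \<xi> = 0"
  shows "L1_norm (\<lambda>x. g x - p x) \<le> L1_norm (\<lambda>x. g x - p x - u x)"
proof -
  have p: "p \<in> H1" "integrable lborel p"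
    using best by (auto simp: best_H1_approx_def H1_def)
  have ge: "L1_norm (\<lambda>x. g x - p x) \<le> L1_norm (\<lambda>x. g x - p x - h x)" if h: "h \<in> H1" for h
  proof -
    have "L1_norm (\<lambda>x. g x - p x) = (INF h\<in>H1. L1_norm (\<lambda>x. g x - h x))"
      using best by (simp add: best_H1_approx_def)
    also have "\<dots> \<le> L1_norm (\<lambda>x. g x - (p x + h x))"
    proof (rule cINF_lower)
      show "bdd_below ((\<lambda>h. L1_norm (\<lambda>x. g x - h x)) ` H1)"
        by (rule bdd_belowI[of _ 0]) (auto simp: L1_norm_def)
    qed (rule H1_add[OF p(1) h])
    finally show ?thesis by (simp add: algebra_simps)
  qed
  define d :: "nat \<Rightarrow> real" where "d n = 1 / real (Suc n)" for n
  have d: "d n > 0" "d \<longlonglongrightarrow> 0" for n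
    unfolding d_def using LIMSEQ_Suc[OF lim_1_over_n] by auto
  let ?f = "\<lambda>x. g x - p x"
  have f: "integrable lborel ?f" using g p by auto
  show ?thesis
  proof (rule LIMSEQ_le_const)
    show "(\<lambda>n. L1_norm (\<lambda>x. ?f x - u x) + L1_norm (\<lambda>x. poisson_smoothing (d n) u x - u x)) \<longlonglongrightarrow> L1_norm (\<lambda>x. ?f x - u x)"
      using tendsto_add[OF tendsto_const poisson_smoothing_tendsto[OF u d]] by simp
    have "L1_norm ?f \<le> L1_norm (\<lambda>x. ?f x - u x) + L1_norm (\<lambda>x. poisson_smoothing (d n) u x - u x)" for n
    proof -
      let ?h = "poisson_smoothing (d n) u"
      have ih: "integrable lborel ?h" by (rule integrable_poisson_smoothing[OF u d(1)])
      have "L1_norm ?f \<le> L1_norm (\<lambda>x. ?f x - ?h x)" by (rule ge[OF poisson_smoothing_in_H1[OF u sp d(1)]])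
      also have "(\<lambda>x. ?f x - ?h x) = (\<lambda>x. (?f x - u x) + (u x - ?h x))" by auto
      also have "L1_norm \<dots> \<le> L1_norm (\<lambda>x. ?f x - u x) + L1_norm (\<lambda>x. u x - ?h x)"
        using f u ih by (intro L1_norm_triangle) auto
      also have "L1_norm (\<lambda>x. u x - ?h x) = L1_norm (\<lambda>x. ?h x - u x)"
        by (simp add: L1_norm_def norm_minus_commute)
      finally show ?thesis .
    qed
    then show "\<exists>N. \<forall>n\<ge>N. L1_norm ?f \<le> L1_norm (\<lambda>x. ?f x - u x) + L1_norm (\<lambda>x. poisson_smoothing (d n) u x - u x)"
      by auto
  qed
qed

text \<open>First-order expansion of the modulus with a quadratic remainder, from \<open>\<bar>1 - q\<bar> \<le> 1 - Re q + \<bar>q\<bar>\<^sup>2 / 2\<close>. It is uniform in \<open>z\<close>,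
  and remains true at \<open>z = 0\<close>, because \<open>w\<close> is measured relative to \<open>z\<close>.\<close>

lemma norm_diff_le_quadratic:
  fixes z w :: complex
  assumes "cmod w \<le> cmod z * r" "r \<ge> 0"
  shows "cmod (z - w) \<le> cmod z - Re (w * cnj (sgn z)) + cmod z * r\<^sup>2 / 2"
proof (cases "z = 0")
  case False
  define q where "q = w / z"
  have w: "w = q * z" using False by (simp add: q_def)
  have q: "cmod q \<le> r" using assms False by (simp add: q_def norm_divide divide_le_eq mult.commute)
  have q1: "cmod (1 - q) \<le> 1 - Re q + r\<^sup>2 / 2"
  proof -
    have "2 * cmod (1 - q) \<le> (cmod (1 - q))\<^sup>2 + 1"
      using sum_squares_bound[of "cmod (1 - q)" 1] by simp
    also have "(cmod (1 - q))\<^sup>2 = 1 - 2 * Re q + (cmod q)\<^sup>2"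
      unfolding cmod_power2 by (simp add: power2_eq_square algebra_simps)
    also have "(cmod q)\<^sup>2 \<le> r\<^sup>2" using q by (intro power_mono) auto
    finally show ?thesis by simp
  qed
  have "cmod (z - w) = cmod z * cmod (1 - q)"
    unfolding w norm_mult[symmetric] by (simp add: algebra_simps)
  also have "\<dots> \<le> cmod z * (1 - Re q + r\<^sup>2 / 2)" using q1 by (intro mult_left_mono) auto
  also have "w * cnj (sgn z) = q * (z * cnj z) / cmod z" by (simp add: w sgn_eq)
  then have "w * cnj (sgn z) = q * cmod z"
    using False by (simp add: complex_norm_square[symmetric] power2_eq_square)
  then have "Re (w * cnj (sgn z)) = Re q * cmod z" by simp
  then have "cmod z * (1 - Re q + r\<^sup>2 / 2) = cmod z - Re (w * cnj (sgn z)) + cmod z * r\<^sup>2 / 2"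
    by (simp add: algebra_simps)
  finally show ?thesis .
qed (use assms in auto)

text \<open>The inequality for \<open>c u\<close> gives \<open>Re (c J) \<le> O(\<bar>c\<bar>\<^sup>2)\<close> for the integral \<open>J\<close> in question and all complex \<open>c\<close>, which is impossible for
  a small multiple \<open>c\<close> of \<open>cnj J\<close> unless \<open>J = 0\<close>.\<close>

lemma L1_minimal_imp_orthogonal:
  fixes f u :: "real \<Rightarrow> complex"
  assumes f: "integrable lborel f" and u: "integrable lborel u" and uf: "\<And>x. cmod (u x) \<le> cmod (f x)"
    and min: "\<And>c. L1_norm f \<le> L1_norm (\<lambda>x. f x - c * u x)"
  shows "(LINT x|lborel. u x * cnj (sgn (f x))) = 0"
proof -
  have [measurable]: "f \<in> borel_measurable borel" "u \<in> borel_measurable borel" using f u by auto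
  define J where "J = (LINT x|lborel. u x * cnj (sgn (f x)))"
  have [measurable]: "(\<lambda>x. cnj (sgn (f x))) \<in> borel_measurable borel"
    unfolding sgn_div_norm by (intro borel_measurable_continuous_on[where f=cnj]) (auto intro!: continuous_intros)
  have iJ: "integrable lborel (\<lambda>x. u x * cnj (sgn (f x)))"
    by (rule integrable_mult_bounded[OF u]) (auto simp: norm_sgn)
  have iRe: "integrable lborel (\<lambda>x. Re (c * (u x * cnj (sgn (f x)))))" for c
    using iJ by (intro integrable_Re integrable_mult_right)
  have *: "Re (c * J) \<le> (cmod c)\<^sup>2 * (L1_norm f / 2)" for c
  proof -
    have "L1_norm f \<le> L1_norm (\<lambda>x. f x - c * u x)" by (rule min)
    also have "\<dots> \<le> (LINT x|lborel. cmod (f x) - Re (c * (u x * cnj (sgn (f x)))) + (cmod c)\<^sup>2 / 2 * cmod (f x))"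
      unfolding L1_norm_def
    proof (rule integral_mono)
      fix x
      have "cmod (c * u x) \<le> cmod (f x) * cmod c"
        using mult_right_mono[OF uf[of x], of "cmod c"] by (simp add: norm_mult mult.commute)
      from norm_diff_le_quadratic[OF this]
      show "cmod (f x - c * u x) \<le> cmod (f x) - Re (c * (u x * cnj (sgn (f x)))) + (cmod c)\<^sup>2 / 2 * cmod (f x)"
        by (simp add: mult_ac)
    qed (use f u in \<open>auto intro!: Bochner_Integration.integrable_add Bochner_Integration.integrable_diff iRe simp del: times_complex.sel\<close>)
    also have "\<dots> = L1_norm f - Re (c * J) + (cmod c)\<^sup>2 / 2 * L1_norm f"
    proof -
      have "Re (c * J) = (LINT x|lborel. Re (c * (u x * cnj (sgn (f x)))))"
        using iJ by (subst integral_Re) (auto simp: J_def)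
      then show ?thesis using f iRe[of c] by (simp add: L1_norm_def del: times_complex.sel)
    qed
    finally show ?thesis by simp
  qed
  show ?thesis
  proof (rule ccontr)
    assume "\<not> ?thesis"
    then have J: "J \<noteq> 0" by (simp add: J_def)
    define L where "L = L1_norm f / 2 + 1"
    have L: "L > 0" "L1_norm f / 2 < L" by (auto simp: L_def L1_norm_def intro: add_nonneg_pos)
    have "Re (cnj J / L * J) = (cmod J)\<^sup>2 / L"
      by (simp add: complex_norm_square[symmetric] mult.commute)
    then have "(cmod J)\<^sup>2 / L \<le> (cmod J / L)\<^sup>2 * (L1_norm f / 2)"
      using *[of "cnj J / L"] L by (simp add: norm_divide)
    also have "\<dots> < (cmod J / L)\<^sup>2 * L"
      using L J by (intro mult_strict_left_mono) auto
    also have "\<dots> = (cmod J)\<^sup>2 / L" using L by (simp add: power2_eq_square)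
    finally show False by simp
  qed
qed

lemma fourier_modulate:
  "fourier (\<lambda>x. u x * exp (- \<i> * complex_of_real (x * b))) \<xi> = fourier u (\<xi> + b)"
  unfolding fourier_def
  by (intro Bochner_Integration.integral_cong) (auto simp: exp_add[symmetric] algebra_simps)

lemma fourier_diff:
  assumes "integrable lborel u" "integrable lborel v"
  shows "fourier (\<lambda>x. u x - v x) \<xi> = fourier u \<xi> - fourier v \<xi>"
proof -
  have "integrable lborel (\<lambda>x. w x * exp (- \<i> * complex_of_real (x * \<xi>)))" if "integrable lborel w" for w
    by (rule integrable_mult_bounded[OF that]) (auto simp: norm_exp_ix)
  then show ?thesis unfolding fourier_def left_diff_distrib using assms
    by (intro Bochner_Integration.integral_diff) auto
qed

lemma fourier_cmult: "fourier (\<lambda>x. c * u x) \<xi> = c * fourier u \<xi>"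
  unfolding fourier_def by (simp add: mult.assoc)

lemma fourier_cnj: "fourier (\<lambda>x. cnj (u x)) \<xi> = cnj (fourier u (- \<xi>))"
  unfolding fourier_def by (subst Bochner_Integration.integral_cnj[symmetric]) (simp add: exp_cnj)

text \<open>The two applications of orthogonality: the first one bounds the spectrum of \<open>\<bar>g - p\<bar>\<close> from below, and this in turn
  bounds the spectrum of \<open>g - p\<close> from above.\<close>

lemma best_approx_spectrum:
  fixes a :: real and g p :: "real \<Rightarrow> complex"
  assumes g: "integrable lborel g"
    and gs: "\<And>\<xi>. \<bar>\<xi>\<bar> > a \<Longrightarrow> fourier g \<xi> = 0" and "a > 0"
    and best: "best_H1_approx g p"
    and ps: "\<And>\<xi>. \<xi> < 0 \<Longrightarrow> fourier p \<xi> = 0"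
  shows "\<xi> > a \<Longrightarrow> fourier p \<xi> = 0"
proof -
  define f where "f x = g x - p x" for x
  have ip: "integrable lborel p" using best by (auto simp: best_H1_approx_def H1_def)
  have f: "integrable lborel f" unfolding f_def using g ip by auto
  then have [measurable]: "f \<in> borel_measurable borel" by auto
  define e where "e b x = exp (- \<i> * complex_of_real (x * b))" for b x
  have e1: "cmod (e b x) = 1" for b x unfolding e_def by (rule norm_exp_ix)
  have [measurable]: "e b \<in> borel_measurable borel" for b unfolding e_def by measurable
  have orth: "(LINT x|lborel. u x * cnj (sgn (f x))) = 0"
    if u: "integrable lborel u" "\<And>x. cmod (u x) \<le> cmod (f x)" "\<And>\<xi>. \<xi> < 0 \<Longrightarrow> fourier u \<xi> = 0" for u
  proof (rule L1_minimal_imp_orthogonal[OF f u(1,2)])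
    fix c show "L1_norm f \<le> L1_norm (\<lambda>x. f x - c * u x)"
      unfolding f_def
      by (rule best_H1_approx_minimal[OF g best]) (use u in \<open>auto simp: fourier_cmult\<close>)
  qed
  have fs: "fourier f \<xi> = 0" if "\<xi> < - a" for \<xi>
    unfolding f_def fourier_diff[OF g ip] using gs[of \<xi>] ps[of \<xi>] that \<open>a > 0\<close> by auto
  define w where "w x = complex_of_real (cmod (f x))" for x
  have w: "integrable lborel w" unfolding w_def using f by auto
  \<comment> \<open>First use of orthogonality, with \<open>u(x) = f(x) exp(-i\<xi>x)\<close>.\<close>
  have ws: "fourier w \<xi> = 0" if "\<xi> < - a" for \<xi>
  proof -
    have "(LINT x|lborel. f x * e \<xi> x * cnj (sgn (f x))) = 0"
    proof (rule orth)
      show "integrable lborel (\<lambda>x. f x * e \<xi> x)"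
        by (rule integrable_mult_bounded[OF f]) (auto simp: e1)
      show "fourier (\<lambda>x. f x * e \<xi> x) \<eta> = 0" if "\<eta> < 0" for \<eta>
        unfolding e_def fourier_modulate using fs \<open>\<xi> < - a\<close> that by auto
    qed (simp add: norm_mult e1)
    also have "(\<lambda>x. f x * e \<xi> x * cnj (sgn (f x))) = (\<lambda>x. w x * e \<xi> x)"
    proof
      fix x
      have "f x * cnj (sgn (f x)) = w x"
        by (cases "f x = 0") (auto simp: w_def sgn_eq complex_norm_square[symmetric] power2_eq_square)
      then show "f x * e \<xi> x * cnj (sgn (f x)) = w x * e \<xi> x" by (metis mult.assoc mult.commute)
    qed
    finally show ?thesis by (simp add: fourier_def e_def)
  qed
  \<comment> \<open>Second use, with \<open>u(x) = \<bar>f(x)\<bar> exp(i\<xi>x)\<close>.\<close>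
  have fs2: "fourier f \<xi> = 0" if "\<xi> > a" for \<xi>
  proof -
    have "(LINT x|lborel. w x * e (- \<xi>) x * cnj (sgn (f x))) = 0"
    proof (rule orth)
      show "integrable lborel (\<lambda>x. w x * e (- \<xi>) x)"
        by (rule integrable_mult_bounded[OF w]) (auto simp: e1)
      show "fourier (\<lambda>x. w x * e (- \<xi>) x) \<eta> = 0" if "\<eta> < 0" for \<eta>
        unfolding e_def fourier_modulate using ws \<open>\<xi> > a\<close> that by auto
    qed (simp add: norm_mult e1 w_def)
    also have "(\<lambda>x. w x * e (- \<xi>) x * cnj (sgn (f x))) = (\<lambda>x. cnj (f x) * e (- \<xi>) x)"
    proof
      fix x
      have "w x * cnj (sgn (f x)) = cnj (f x)"
        by (cases "f x = 0") (auto simp: w_def sgn_eq)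
      then show "w x * e (- \<xi>) x * cnj (sgn (f x)) = cnj (f x) * e (- \<xi>) x" by (metis mult.assoc mult.commute)
    qed
    finally have "fourier (\<lambda>x. cnj (f x)) (- \<xi>) = 0" by (simp add: fourier_def e_def)
    then show ?thesis by (simp add: fourier_cnj)
  qed
  show "fourier p \<xi> = 0" if "\<xi> > a"
    using fs2[OF that] gs[of \<xi>] that \<open>a > 0\<close> unfolding f_def[abs_def] fourier_diff[OF g ip] by auto
qed

lemma fourier_eq_0_outside_supp: "\<xi> \<notin> supp (fourier u) \<Longrightarrow> fourier u \<xi> = 0"
  unfolding supp_def using closure_subset[of "{\<xi>. fourier u \<xi> \<noteq> 0}"] by auto

theorem theorem3:
  fixes a :: real and g p :: "real \<Rightarrow> complex"
  assumes "a > 0"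
    and "integrable lborel g"
    and "supp (fourier g) \<subseteq> {-a..a}"
    and "best_H1_approx g p"
  shows "supp (fourier p) \<subseteq> {0..a}"
proof -
  have p: "p \<in> H1" using assms(4) by (simp add: best_H1_approx_def)
  have neg: "fourier p \<xi> = 0" if "\<xi> < 0" for \<xi>
    by (rule fourier_H1_eq_0[OF p that])
  have g: "fourier g \<xi> = 0" if "\<bar>\<xi>\<bar> > a" for \<xi>
  proof (rule fourier_eq_0_outside_supp)
    have "\<xi> \<notin> {-a..a}" using that by auto
    then show "\<xi> \<notin> supp (fourier g)" using assms(3) by blast
  qed
  have pos: "fourier p \<xi> = 0" if "\<xi> > a" for \<xi>
    by (rule best_approx_spectrum[OF assms(2) g assms(1,4) neg that])
  have "{\<xi>. fourier p \<xi> \<noteq> 0} \<subseteq> {0..a}"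
    using neg pos by (force simp: not_le[symmetric])
  then show ?thesis
    unfolding supp_def by (rule closure_minimal) simp
qed

end
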